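(* Let $u$ be a sufficiently smooth solution, on $\Omega$ and with the boundary conditions described in the context, of the Navier-Stokes system $$u_t+\nu Au+(u\cdot\nabla)u+\nabla p=g,\qquad \nabla\cdot u=0,$$ or of the Euler system $$u_t+(u\cdot\nabla)u+\nabla p=0,\qquad \nabla\cdot u=0,$$ and let $\omega=\nabla\times u$. Then, at each time $t$ of the interval on which $u$ is such a solution, $$A^{s}u=A^{s-1}(\nabla\times\omega)$$ for every real order $s$ allowed by the smoothness of $u$, i.e. every $s$ such that $u(\cdot,t)\in D(A^{s})$.
   Context: $\Omega$ is either a periodic box in $\mathbb{R}^3$ (with periodic boundary conditions, constant vectors being factored out, i.e. fields have mean zero) or a bounded Lipschitz domain in $\mathbb{R}^3$, with boundary smooth enough that the usual Sobolev inequalities hold, with zero (no-slip, Dirichlet) boundary conditions. $u=(u_1,u_2,u_3)$ with $u_i=u_i(x,t)$ is the velocity, $p=p(x,t)$ the pressure, $g=g(x,t)$ the $\mathbb{R}^3$-valued external force, and $\nu>0$ the viscosity. $A=-\Delta$ (acting componentwise, with periodic boundary conditions on mean-zero fields if $\Omega$ is a periodic box, and with zero Dirichlet boundary conditions if $\Omega$ is a bounded Lipschitz domain) is a positive definite self-adjoint operator on $L^2(\Omega)$ with eigenvalues $0<\lambda_1<\lambda_2<\cdots$ and corresponding eigenspaces $E_1,E_2,\dots$. It is invertible, and its real powers $A^{s}$ are defined spectrally, with domain $D(A^s)$. The curl is $\nabla\times u=(\partial_y u_3-\partial_z u_2,\ \partial_z u_1-\partial_x u_3,\ \partial_x u_2-\partial_y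 u_1)$. "Sufficiently smooth" means in particular that $u(\cdot,t)$ satisfies the boundary conditions and is regular enough for $Au(\cdot,t)$ and $\nabla\times\nabla\times u(\cdot,t)$ to be defined, i.e. $u(\cdot,t)\in D(A)$. *)

theory Defs
  imports "HOL-Analysis.Analysis"
begin

section \<open>Domains and test functions\<close>

text \<open>Locally, after a rigid motion, a Lipschitz domain is the region above the graph of a
  Lipschitz function.\<close>

definition lipschitz_domain :: "(real^3) set \<Rightarrow> bool" where
  "lipschitz_domain \<Omega> \<longleftrightarrow>
     open \<Omega> \<and> connected \<Omega> \<and> bounded \<Omega> \<and> \<Omega> \<noteq> {} \<and>
     (\<forall>z\<in>frontier \<Omega>. \<exists>r>0. \<exists>(Q :: real^3 \<Rightarrow> real^3) (\<gamma> :: real \<times> real \<Rightarrow> real) L.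
        orthogonal_transformation Q \<and> L-lipschitz_on UNIV \<gamma> \<and>
        (\<forall>x\<in>ball z r. x \<in> \<Omega> \<longleftrightarrow> \<gamma> (Q x $ 1, Q x $ 2) < Q x $ 3))"

text \<open>\<open>Periodic a b\<close> is the box with opposite corners \<open>a\<close> and \<open>b\<close> carrying periodic boundary
  conditions; \<open>Dirichlet \<Omega>\<close> is \<open>\<Omega>\<close> with zero boundary conditions.\<close>

datatype flow_domain = Periodic "real^3" "real^3" | Dirichlet "(real^3) set"

fun admissible :: "flow_domain \<Rightarrow> bool" where
  "admissible (Periodic a b) \<longleftrightarrow> (\<forall>i. a $ i < b $ i)"
| "admissible (Dirichlet \<Omega>) \<longleftrightarrow> lipschitz_domain \<Omega>"

fun region :: "flow_domain \<Rightarrow> (real^3) set" where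
  "region (Periodic a b) = box a b"
| "region (Dirichlet \<Omega>) = \<Omega>"

abbreviation dom_measure :: "flow_domain \<Rightarrow> (real^3) measure" where
  "dom_measure D \<equiv> lebesgue_on (region D)"

definition pd :: "3 \<Rightarrow> (real^3 \<Rightarrow> real) \<Rightarrow> real^3 \<Rightarrow> real" where
  "pd i \<phi> x = frechet_derivative \<phi> (at x) (axis i 1)"

definition smooth :: "(real^3 \<Rightarrow> real) \<Rightarrow> bool" where
  "smooth \<phi> \<longleftrightarrow> (\<forall>is. foldr pd is \<phi> differentiable_on UNIV)"

text \<open>Test functions: smooth functions on the torus in the periodic case, smooth functions with
  compact support in \<open>\<Omega>\<close> in the Dirichlet case. Fields on the torus only enter through their values
  on the open box; all distributional derivatives below are taken against these test functions, so
  in the periodic case they are derivatives on the torus. Operators given by \<open>SOME\<close> choose a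
  representative of a result that is unique up to null sets.\<close>

fun test_fun :: "flow_domain \<Rightarrow> (real^3 \<Rightarrow> real) \<Rightarrow> bool" where
  "test_fun (Periodic a b) \<phi> \<longleftrightarrow>
     smooth \<phi> \<and> (\<forall>i x. \<phi> (x + (b $ i - a $ i) *\<^sub>R axis i 1) = \<phi> x)"
| "test_fun (Dirichlet \<Omega>) \<phi> \<longleftrightarrow>
     smooth \<phi> \<and> compact (closure {x. \<phi> x \<noteq> 0}) \<and> closure {x. \<phi> x \<noteq> 0} \<subseteq> \<Omega>"

text \<open>The torus is compact, hence local integrability is integrability there.\<close>

fun loc_integrable :: "flow_domain \<Rightarrow> (real^3 \<Rightarrow> 'b::euclidean_space) \<Rightarrow> bool" where
  "loc_integrable (Periodic a b) f \<longleftrightarrow> integrable (lebesgue_on (box a b)) f"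
| "loc_integrable (Dirichlet \<Omega>) f \<longleftrightarrow>
     (\<forall>K. compact K \<and> K \<subseteq> \<Omega> \<longrightarrow> integrable (lebesgue_on K) f)"

section \<open>Distributional derivatives\<close>

definition has_weak_pd ::
    "flow_domain \<Rightarrow> 3 \<Rightarrow> (real^3 \<Rightarrow> real) \<Rightarrow> (real^3 \<Rightarrow> real) \<Rightarrow> bool" where
  "has_weak_pd D i f f' \<longleftrightarrow> loc_integrable D f \<and> loc_integrable D f' \<and>
     (\<forall>\<phi>. test_fun D \<phi> \<longrightarrow>
        (\<integral>x. f' x * \<phi> x \<partial>dom_measure D) = - (\<integral>x. f x * pd i \<phi> x \<partial>dom_measure D))"

definition weak_pd :: "flow_domain \<Rightarrow> 3 \<Rightarrow> (real^3 \<Rightarrow> real) \<Rightarrow> real^3 \<Rightarrow> real" where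
  "weak_pd D i f = (SOME f'. has_weak_pd D i f f')"

definition has_weak_grad :: "flow_domain \<Rightarrow> (real^3 \<Rightarrow> real) \<Rightarrow> (real^3 \<Rightarrow> real^3) \<Rightarrow> bool" where
  "has_weak_grad D f G \<longleftrightarrow> (\<forall>i. has_weak_pd D i f (\<lambda>x. G x $ i))"

definition div_free :: "flow_domain \<Rightarrow> (real^3 \<Rightarrow> real^3) \<Rightarrow> bool" where
  "div_free D v \<longleftrightarrow> loc_integrable D v \<and>
     (\<forall>\<phi>. test_fun D \<phi> \<longrightarrow> (\<integral>x. (\<Sum>i\<in>UNIV. v x $ i * pd i \<phi> x) \<partial>dom_measure D) = 0)"

text \<open>Each component of \<open>w\<close> represents the distribution \<open>\<partial>\<^sub>j v\<^sub>k - \<partial>\<^sub>k v\<^sub>j\<close>, \<open>(j, k) = (2,3), (3,1), (1,2)\<close>.\<close>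

definition has_curl :: "flow_domain \<Rightarrow> (real^3 \<Rightarrow> real^3) \<Rightarrow> (real^3 \<Rightarrow> real^3) \<Rightarrow> bool" where
  "has_curl D v w \<longleftrightarrow> loc_integrable D v \<and> loc_integrable D w \<and>
     (\<forall>\<phi>. test_fun D \<phi> \<longrightarrow>
        (\<integral>x. w x $ 1 * \<phi> x \<partial>dom_measure D)
          = - (\<integral>x. v x $ 3 * pd 2 \<phi> x - v x $ 2 * pd 3 \<phi> x \<partial>dom_measure D) \<and>
        (\<integral>x. w x $ 2 * \<phi> x \<partial>dom_measure D)
          = - (\<integral>x. v x $ 1 * pd 3 \<phi> x - v x $ 3 * pd 1 \<phi> x \<partial>dom_measure D) \<and>
        (\<integral>x. w x $ 3 * \<phi> x \<partial>dom_measure D)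
          = - (\<integral>x. v x $ 2 * pd 1 \<phi> x - v x $ 1 * pd 2 \<phi> x \<partial>dom_measure D))"

definition curl :: "flow_domain \<Rightarrow> (real^3 \<Rightarrow> real^3) \<Rightarrow> real^3 \<Rightarrow> real^3" where
  "curl D v = (SOME w. has_curl D v w)"

section \<open>The operator \<open>A = -\<Delta>\<close>\<close>

definition square_integrable :: "flow_domain \<Rightarrow> (real^3 \<Rightarrow> 'b::euclidean_space) \<Rightarrow> bool" where
  "square_integrable D f \<longleftrightarrow>
     f \<in> borel_measurable (dom_measure D) \<and> integrable (dom_measure D) (\<lambda>x. (norm (f x))\<^sup>2)"

definition l2_norm :: "flow_domain \<Rightarrow> (real^3 \<Rightarrow> 'b::euclidean_space) \<Rightarrow> real" where
  "l2_norm D f = sqrt (\<integral>x. (norm (f x))\<^sup>2 \<partial>dom_measure D)"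

definition l2_inner :: "flow_domain \<Rightarrow> (real^3 \<Rightarrow> real^3) \<Rightarrow> (real^3 \<Rightarrow> real^3) \<Rightarrow> real" where
  "l2_inner D v w = (\<integral>x. v x \<bullet> w x \<partial>dom_measure D)"

text \<open>The underlying Hilbert space; constants are factored out in the periodic case. Its elements
  are functions, to be identified when they agree almost everywhere.\<close>

fun mean_condition :: "flow_domain \<Rightarrow> (real^3 \<Rightarrow> real^3) \<Rightarrow> bool" where
  "mean_condition (Periodic a b) v \<longleftrightarrow> (\<integral>x. v x \<partial>lebesgue_on (box a b)) = 0"
| "mean_condition (Dirichlet \<Omega>) v \<longleftrightarrow> True"

definition L2_fields :: "flow_domain \<Rightarrow> (real^3 \<Rightarrow> real^3) set" where
  "L2_fields D = {v. square_integrable D v \<and> mean_condition D v}"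

text \<open>The closure of the test functions in \<open>H\<^sup>1\<close>, i.e. the periodic space \<open>H\<^sup>1\<close> or \<open>H\<^sup>1\<^sub>0\<close>: this encodes
  the boundary conditions.\<close>

definition H1_bc :: "flow_domain \<Rightarrow> (real^3 \<Rightarrow> real) set" where
  "H1_bc D = {f. square_integrable D f \<and>
     (\<exists>(G :: real^3 \<Rightarrow> real^3) (\<phi> :: nat \<Rightarrow> real^3 \<Rightarrow> real).
        square_integrable D G \<and> (\<forall>n. test_fun D (\<phi> n)) \<and>
        (\<lambda>n. l2_norm D (\<lambda>x. \<phi> n x - f x)) \<longlonglongrightarrow> 0 \<and>
        (\<lambda>n. l2_norm D (\<lambda>x. (\<chi> i. pd i (\<phi> n) x) - G x)) \<longlonglongrightarrow> 0)}"

text \<open>\<open>A v = h\<close>, with \<open>D(A) = {v \<in> H\<^sup>1 with boundary conditions. \<Delta>v \<in> L\<^sup>2}\<close>. This is the domain on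
  which the Laplacian of a Lipschitz domain is self-adjoint; it can be larger than \<open>H\<^sup>2 \<inter> H\<^sup>1\<^sub>0\<close>.\<close>

definition A_graph :: "flow_domain \<Rightarrow> (real^3 \<Rightarrow> real^3) \<Rightarrow> (real^3 \<Rightarrow> real^3) \<Rightarrow> bool" where
  "A_graph D v h \<longleftrightarrow> v \<in> L2_fields D \<and> h \<in> L2_fields D \<and>
     (\<forall>k. (\<lambda>x. v x $ k) \<in> H1_bc D \<and>
       (\<forall>\<phi>. test_fun D \<phi> \<longrightarrow>
          (\<integral>x. h x $ k * \<phi> x \<partial>dom_measure D)
            = - (\<integral>x. v x $ k * (\<Sum>i\<in>UNIV. pd i (pd i \<phi>) x) \<partial>dom_measure D)))"

definition A_dom :: "flow_domain \<Rightarrow> (real^3 \<Rightarrow> real^3) set" where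
  "A_dom D = {v. \<exists>h. A_graph D v h}"

definition A_op :: "flow_domain \<Rightarrow> (real^3 \<Rightarrow> real^3) \<Rightarrow> real^3 \<Rightarrow> real^3" where
  "A_op D v = (SOME h. A_graph D v h)"

definition eigenspace :: "flow_domain \<Rightarrow> real \<Rightarrow> (real^3 \<Rightarrow> real^3) set" where
  "eigenspace D l = {e. A_graph D e (\<lambda>x. l *\<^sub>R e x)}"

definition eigenvalues :: "flow_domain \<Rightarrow> real set" where
  "eigenvalues D = {l. \<exists>e\<in>eigenspace D l. \<not> (AE x in dom_measure D. e x = 0)}"

definition is_eigenprojection ::
    "flow_domain \<Rightarrow> real \<Rightarrow> (real^3 \<Rightarrow> real^3) \<Rightarrow> (real^3 \<Rightarrow> real^3) \<Rightarrow> bool" where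
  "is_eigenprojection D l v q \<longleftrightarrow>
     q \<in> eigenspace D l \<and> (\<forall>e\<in>eigenspace D l. l2_inner D (\<lambda>x. v x - q x) e = 0)"

text \<open>\<open>A\<^sup>s v = w\<close>: with \<open>P l\<close> the orthogonal projection of \<open>v\<close> onto the eigenspace of \<open>l\<close>, the series
  of all \<open>l\<^sup>s P l\<close> converges to \<open>w\<close> in \<open>L\<^sup>2\<close>. The terms are orthogonal, so \<open>D(A\<^sup>s)\<close> consists of the \<open>v\<close>
  for which the sum of all \<open>l\<^sup>2\<^sup>s \<parallel>P l\<parallel>\<^sup>2\<close> is finite; it is the whole space when \<open>s \<le> 0\<close>.
  All eigenvalues are positive, so \<open>powr\<close> is the usual real power.\<close>

definition power_graph ::
    "flow_domain \<Rightarrow> real \<Rightarrow> (real^3 \<Rightarrow> real^3) \<Rightarrow> (real^3 \<Rightarrow> real^3) \<Rightarrow> bool" where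
  "power_graph D s v w \<longleftrightarrow> v \<in> L2_fields D \<and> w \<in> L2_fields D \<and>
     (\<exists>P. (\<forall>l\<in>eigenvalues D. is_eigenprojection D l v (P l)) \<and>
        ((\<lambda>F. l2_norm D (\<lambda>x. (\<Sum>l\<in>F. (l powr s) *\<^sub>R P l x) - w x)) \<longlongrightarrow> 0)
          (finite_subsets_at_top (eigenvalues D)))"

definition A_power_dom :: "flow_domain \<Rightarrow> real \<Rightarrow> (real^3 \<Rightarrow> real^3) set" where
  "A_power_dom D s = {v. \<exists>w. power_graph D s v w}"

definition A_power :: "flow_domain \<Rightarrow> real \<Rightarrow> (real^3 \<Rightarrow> real^3) \<Rightarrow> real^3 \<Rightarrow> real^3" where
  "A_power D s v = (SOME w. power_graph D s v w)"

section \<open>Solutions\<close>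

text \<open>\<open>(v \<cdot> \<nabla>) v\<close>\<close>

definition convection :: "flow_domain \<Rightarrow> (real^3 \<Rightarrow> real^3) \<Rightarrow> real^3 \<Rightarrow> real^3" where
  "convection D v x = (\<chi> i. \<Sum>j\<in>UNIV. v x $ j * weak_pd D j (\<lambda>y. v y $ i) x)"

text \<open>The equations hold almost everywhere in space at every time. Membership in \<open>D(A)\<close> contains the
  boundary conditions and is the only spatial regularity imposed; time derivatives are one-sided at
  end points belonging to \<open>I\<close>.\<close>

definition navier_stokes_solution ::
    "flow_domain \<Rightarrow> real \<Rightarrow> (real \<Rightarrow> real^3 \<Rightarrow> real^3) \<Rightarrow> real set \<Rightarrow>
     (real \<Rightarrow> real^3 \<Rightarrow> real^3) \<Rightarrow> (real \<Rightarrow> real^3 \<Rightarrow> real) \<Rightarrow> bool" where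
  "navier_stokes_solution D \<nu> g I u p \<longleftrightarrow>
     (\<forall>t\<in>I. u t \<in> A_dom D \<and> div_free D (u t) \<and>
        (\<exists>ut gradp. has_weak_grad D (p t) gradp \<and>
           (AE x in dom_measure D.
              ((\<lambda>\<tau>. u \<tau> x) has_vector_derivative ut x) (at t within I) \<and>
              ut x + \<nu> *\<^sub>R A_op D (u t) x + convection D (u t) x + gradp x = g t x)))"

definition euler_solution ::
    "flow_domain \<Rightarrow> real set \<Rightarrow> (real \<Rightarrow> real^3 \<Rightarrow> real^3) \<Rightarrow> (real \<Rightarrow> real^3 \<Rightarrow> real) \<Rightarrow> bool" where
  "euler_solution D I u p \<longleftrightarrow>
     (\<forall>t\<in>I. u t \<in> A_dom D \<and> div_free D (u t) \<and>
        (\<exists>ut gradp. has_weak_grad D (p t) gradp \<and>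
           (AE x in dom_measure D.
              ((\<lambda>\<tau>. u \<tau> x) has_vector_derivative ut x) (at t within I) \<and>
              ut x + convection D (u t) x + gradp x = 0)))"

end

theory Submission imports Defs
begin

text \<open>At each instant, \<open>v = u t\<close> lies in the domain of \<open>A = - \<Delta>\<close> and is divergence free. Then
  \<open>curl (curl v) = grad (div v) - \<Delta>v = A v\<close>, and the claim is the power law \<open>A\<^sup>s v = A\<^sup>s\<^sup>-\<^sup>1 (A v)\<close>.

  For the first step, \<open>v\<close> has components in the closure of the test functions in \<open>H\<^sup>1\<close>, hence weak
  derivatives in \<open>L\<^sup>2\<close> (integration by parts for test functions and passage to the limit), so that its
  distributional curl is represented by a field (\<open>curl_exists\<close>). The identity for the double curl is
  obtained by moving all derivatives onto the test function and using the symmetry of mixed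
  derivatives (\<open>curl_curl\<close>). Since \<open>curl\<close> chooses a representative, uniqueness up to null sets is
  needed (\<open>curl_unique\<close>). It follows from the fundamental lemma of the calculus of variations, whose
  test functions are built from \<open>exp (- 1 / y)\<close>, and in the periodic case from sines.

  For the second step, let \<open>P l\<close> be the orthogonal projection of \<open>v\<close> onto the eigenspace of \<open>l\<close>. Green's
  formula, extended from test functions to the form domain, makes \<open>A\<close> symmetric and nonnegative
  (\<open>A_graph_Dirichlet_form\<close>). By symmetry the projection of \<open>A v\<close> is \<open>l P l\<close> (\<open>eigenprojection_A\<close>), and by
  nonnegativity of \<open>l\<close> the series of all \<open>l\<^sup>s\<^sup>-\<^sup>1 (l P l)\<close> is that of all \<open>l\<^sup>s P l\<close>. So convergence of one gives
  convergence of the other, to the same limit, which is unique up to null sets (\<open>power_graph_unique\<close>).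
  Neither the completeness of the eigenfunctions nor the discreteness of the spectrum is used.\<close>

section \<open>Calculus of smooth functions\<close>

lemma pd_eqI:
  assumes "(\<phi> has_derivative \<phi>') (at x)"
  shows "pd i \<phi> x = \<phi>' (axis i 1)"
  using frechet_derivative_at[OF assms] by (simp add: pd_def)

lemma smooth_differentiable: "smooth \<phi> \<Longrightarrow> \<phi> differentiable (at x)"
  by (metis smooth_def differentiable_on_def UNIV_I foldr.simps(1) id_apply)

lemma smooth_has_derivative:
  "smooth \<phi> \<Longrightarrow> (\<phi> has_derivative frechet_derivative \<phi> (at x)) (at x)"
  using smooth_differentiable frechet_derivative_works by blast

lemma smooth_pd: "smooth \<phi> \<Longrightarrow> smooth (pd i \<phi>)"
  unfolding smooth_def
proof
  fix "is" assume "\<forall>is. foldr pd is \<phi> differentiable_on UNIV"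
  then have "foldr pd (is @ [i]) \<phi> differentiable_on UNIV" by blast
  then show "foldr pd is (pd i \<phi>) differentiable_on UNIV" by simp
qed

lemma smooth_continuous: "smooth \<phi> \<Longrightarrow> continuous_on A \<phi>"
  by (meson continuous_at_imp_continuous_on differentiable_imp_continuous_within smooth_differentiable)

text \<open>Smoothness is the largest property of differentiable functions that is stable under partial
  derivatives.\<close>

lemma smooth_coinduct:
  assumes "\<phi> \<in> S"
    and diff: "\<And>\<phi> x. \<phi> \<in> S \<Longrightarrow> \<phi> differentiable (at x)"
    and pd: "\<And>\<phi> i. \<phi> \<in> S \<Longrightarrow> pd i \<phi> \<in> S"
  shows "smooth \<phi>"
proof -
  have "foldr pd is \<phi> \<in> S" for "is" by (induction "is") (simp_all add: assms)
  then show ?thesis unfolding smooth_def by (simp add: diff differentiable_on_def)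
qed

text \<open>The algebra generated by the smooth functions, closed under composition with infinitely
  differentiable functions of one real variable. It turns out to contain nothing new.\<close>

inductive_set smooth_hull :: "(real^3 \<Rightarrow> real) set" where
  base: "smooth \<phi> \<Longrightarrow> \<phi> \<in> smooth_hull"
| add: "\<phi> \<in> smooth_hull \<Longrightarrow> \<psi> \<in> smooth_hull \<Longrightarrow> (\<lambda>x. \<phi> x + \<psi> x) \<in> smooth_hull"
| mult: "\<phi> \<in> smooth_hull \<Longrightarrow> \<psi> \<in> smooth_hull \<Longrightarrow> (\<lambda>x. \<phi> x * \<psi> x) \<in> smooth_hull"
| comp: "\<phi> \<in> smooth_hull \<Longrightarrow> (\<And>n y. (F n has_real_derivative F (Suc n) y) (at y)) \<Longrightarrow>
           (\<lambda>x. F (n::nat) (\<phi> x)) \<in> smooth_hull"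

lemma smooth_hull_differentiable: "\<phi> \<in> smooth_hull \<Longrightarrow> \<phi> differentiable (at x)"
proof (induction arbitrary: x rule: smooth_hull.induct)
  case (comp \<phi> F n)
  have "F n differentiable (at (\<phi> x))"
    using comp.hyps(2) real_differentiable_def by blast
  then show ?case
    using differentiable_chain_at[OF comp.IH[of x], of "F n"] by (simp add: o_def)
qed (simp_all add: smooth_differentiable)

lemma pd_add:
  assumes "\<phi> differentiable (at x)" "\<psi> differentiable (at x)"
  shows "pd i (\<lambda>x. \<phi> x + \<psi> x) x = pd i \<phi> x + pd i \<psi> x"
proof -
  have "((\<lambda>x. \<phi> x + \<psi> x) has_derivative
      (\<lambda>h. frechet_derivative \<phi> (at x) h + frechet_derivative \<psi> (at x) h)) (at x)"
    using assms frechet_derivative_works has_derivative_add by blast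
  from pd_eqI[OF this] show ?thesis by (simp add: pd_def)
qed

lemma pd_mult:
  assumes "\<phi> differentiable (at x)" "\<psi> differentiable (at x)"
  shows "pd i (\<lambda>x. \<phi> x * \<psi> x) x = \<phi> x * pd i \<psi> x + pd i \<phi> x * \<psi> x"
proof -
  have "((\<lambda>x. \<phi> x * \<psi> x) has_derivative
      (\<lambda>h. \<phi> x * frechet_derivative \<psi> (at x) h + frechet_derivative \<phi> (at x) h * \<psi> x)) (at x)"
    using assms frechet_derivative_works has_derivative_mult by blast
  from pd_eqI[OF this] show ?thesis by (simp add: pd_def)
qed

lemma pd_comp:
  assumes "\<phi> differentiable (at x)" "(f has_real_derivative f') (at (\<phi> x))"
  shows "pd i (\<lambda>x. f (\<phi> x)) x = f' * pd i \<phi> x"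
proof -
  have "((\<lambda>x. f (\<phi> x)) has_derivative (\<lambda>h. f' * frechet_derivative \<phi> (at x) h)) (at x)"
    using has_derivative_compose[OF assms(1)[unfolded frechet_derivative_works]
        assms(2)[unfolded has_field_derivative_def]] .
  from pd_eqI[OF this] show ?thesis by (simp add: pd_def)
qed

lemma smooth_hull_pd: "\<phi> \<in> smooth_hull \<Longrightarrow> pd i \<phi> \<in> smooth_hull"
proof (induction rule: smooth_hull.induct)
  case (base \<phi>)
  then show ?case using smooth_pd smooth_hull.base by blast
next
  case (add \<phi> \<psi>)
  have "pd i (\<lambda>x. \<phi> x + \<psi> x) = (\<lambda>x. pd i \<phi> x + pd i \<psi> x)"
    using add.hyps by (auto simp: pd_add smooth_hull_differentiable)
  then show ?case using add by (simp add: smooth_hull.add)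
next
  case (mult \<phi> \<psi>)
  have "pd i (\<lambda>x. \<phi> x * \<psi> x) = (\<lambda>x. \<phi> x * pd i \<psi> x + pd i \<phi> x * \<psi> x)"
    using mult.hyps by (auto simp: pd_mult smooth_hull_differentiable)
  then show ?case using mult by (simp add: smooth_hull.add smooth_hull.mult)
next
  case (comp \<phi> F n)
  have "pd i (\<lambda>x. F n (\<phi> x)) = (\<lambda>x. F (Suc n) (\<phi> x) * pd i \<phi> x)"
    using comp.hyps by (intro ext pd_comp smooth_hull_differentiable)
  then show ?case
    using smooth_hull.mult[OF smooth_hull.comp[of \<phi> F "Suc n", OF comp.hyps] comp.IH] by simp
qed

lemma smooth_hull_eq: "\<phi> \<in> smooth_hull \<longleftrightarrow> smooth \<phi>"
proof
  show "smooth \<phi>" if "\<phi> \<in> smooth_hull"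
    using that by (rule smooth_coinduct) (simp_all add: smooth_hull_differentiable smooth_hull_pd)
qed (rule smooth_hull.base)

lemma smooth_add: "smooth \<phi> \<Longrightarrow> smooth \<psi> \<Longrightarrow> smooth (\<lambda>x. \<phi> x + \<psi> x)"
  unfolding smooth_hull_eq[symmetric] by (rule smooth_hull.add)

lemma smooth_mult: "smooth \<phi> \<Longrightarrow> smooth \<psi> \<Longrightarrow> smooth (\<lambda>x. \<phi> x * \<psi> x)"
  unfolding smooth_hull_eq[symmetric] by (rule smooth_hull.mult)

lemma smooth_comp:
  fixes F :: "nat \<Rightarrow> real \<Rightarrow> real"
  assumes "smooth \<phi>" "\<And>n y. (F n has_real_derivative F (Suc n) y) (at y)"
  shows "smooth (\<lambda>x. F n (\<phi> x))"
  using assms unfolding smooth_hull_eq[symmetric] by (rule smooth_hull.comp)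

lemma smooth_const: "smooth (\<lambda>x. c)"
proof (rule smooth_coinduct)
  show "(\<lambda>x. c) \<in> {\<lambda>x::real^3. c | c::real. True}" by blast
  show "pd i \<phi> \<in> {\<lambda>x. c | c. True}" if "\<phi> \<in> {\<lambda>x. c | c. True}" for \<phi> i
  proof -
    from that obtain c where "\<phi> = (\<lambda>x. c)" by blast
    then have "pd i \<phi> = (\<lambda>x. 0)" using pd_eqI[OF has_derivative_const] by blast
    then show ?thesis by blast
  qed
qed auto

lemma smooth_coord: "smooth (\<lambda>x. x $ k)"
proof (rule smooth_coinduct)
  let ?S = "insert (\<lambda>x. x $ k) {\<phi>. smooth \<phi>}"
  have d: "((\<lambda>x::real^3. x $ k) has_derivative (\<lambda>x. x $ k)) (at x)" for x
    by (rule bounded_linear_imp_has_derivative[OF bounded_linear_vec_nth])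
  show "(\<lambda>x. x $ k) \<in> ?S" by simp
  show "\<phi> differentiable at x" if "\<phi> \<in> ?S" for \<phi> x
    using that d[of x] smooth_differentiable by (auto simp: differentiable_def)
  show "pd i \<phi> \<in> ?S" if "\<phi> \<in> ?S" for \<phi> i
  proof (cases "smooth \<phi>")
    case True then show ?thesis by (simp add: smooth_pd)
  next
    case False
    then have "\<phi> = (\<lambda>x. x $ k)" using that by simp
    then have "pd i \<phi> = (\<lambda>x. axis i 1 $ k)" using pd_eqI[OF d] by blast
    then show ?thesis by (simp add: smooth_const)
  qed
qed

lemma smooth_diff: "smooth \<phi> \<Longrightarrow> smooth \<psi> \<Longrightarrow> smooth (\<lambda>x. \<phi> x - \<psi> x)"
  using smooth_add[OF _ smooth_mult[OF smooth_const[of "-1"], of \<psi>], of \<phi>] by simp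

lemma smooth_prod: "finite K \<Longrightarrow> (\<And>k. k \<in> K \<Longrightarrow> smooth (\<phi> k)) \<Longrightarrow> smooth (\<lambda>x. \<Prod>k\<in>K. \<phi> k x)"
  by (induction K rule: finite_induct) (simp_all add: smooth_const smooth_mult)

lemma smooth_exp: "smooth \<phi> \<Longrightarrow> smooth (\<lambda>x. exp (\<phi> x))"
  by (rule smooth_comp[of \<phi> "\<lambda>_. exp"]) (auto intro: DERIV_exp)

lemma smooth_sin:
  assumes "smooth \<phi>" shows "smooth (\<lambda>x. sin (\<phi> x))"
proof -
  \<comment> \<open>Each derivative of the sine shifts its argument by \<open>pi / 2\<close>.\<close>
  have "((\<lambda>y. sin (y + n * pi / 2)) has_real_derivative sin (y + Suc n * pi / 2)) (at y)"
    for n :: nat and y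
  proof -
    have "sin (y + Suc n * pi / 2) = cos (y + n * pi / 2)"
      using sin_add[of "y + n * pi / 2" "pi/2"] by (simp add: field_simps)
    then show ?thesis by (auto intro!: derivative_eq_intros)
  qed
  from smooth_comp[OF assms, of "\<lambda>n y. sin (y + n * pi / 2)", OF this, of 0]
  show ?thesis by simp
qed

text \<open>\<open>flat 1\<close> is \<open>exp (- 1 / y)\<close>, extended by \<open>0\<close> to \<open>y \<le> 0\<close>. With a polynomial \<open>p\<close> in \<open>1 / y\<close> as an
  additional factor, the family is closed under differentiation, which acts on \<open>p\<close> as \<open>flat_deriv\<close>.\<close>

definition flat :: "real poly \<Rightarrow> real \<Rightarrow> real" where
  "flat p y = (if y > 0 then poly p (inverse y) * exp (- inverse y) else 0)"

definition flat_deriv :: "real poly \<Rightarrow> real poly" where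
  "flat_deriv p = [:0, 0, 1:] * (p - pderiv p)"

lemma poly_exp_tendsto_0: "((\<lambda>y::real. poly p y * exp (- y)) \<longlongrightarrow> 0) at_top"
proof -
  have "((\<lambda>y::real. \<Sum>i\<le>degree p. coeff p i * (y ^ i / exp y)) \<longlongrightarrow> (\<Sum>i\<le>degree p. coeff p i * 0)) at_top"
    by (intro tendsto_intros tendsto_power_div_exp_0)
  moreover have "(\<Sum>i\<le>degree p. coeff p i * (y ^ i / exp y)) = poly p y * exp (- y)" for y :: real
    by (simp add: poly_altdef exp_minus divide_inverse sum_distrib_right mult.assoc)
  ultimately show ?thesis by simp
qed

lemma flat_tendsto_0: "((\<lambda>y. flat p y / y) \<longlongrightarrow> 0) (at 0)"
proof (rule filterlim_split_at)
  show "((\<lambda>y. flat p y / y) \<longlongrightarrow> 0) (at_left 0)"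
    by (rule tendsto_eventually) (auto simp: flat_def eventually_at_filter)
  have "((\<lambda>y::real. poly ([:0,1:] * p) (inverse y) * exp (- inverse y)) \<longlongrightarrow> 0) (at_right 0)"
    using filterlim_compose[OF poly_exp_tendsto_0 filterlim_inverse_at_top_right] .
  then show "((\<lambda>y. flat p y / y) \<longlongrightarrow> 0) (at_right 0)"
    by (rule Lim_transform_eventually) (auto simp: flat_def eventually_at_filter divide_inverse mult_ac)
qed

lemma flat_has_derivative: "(flat p has_real_derivative flat (flat_deriv p) y) (at y)"
proof (cases y "0::real" rule: linorder_cases)
  case less
  have d: "((\<lambda>_. 0) has_real_derivative 0) (at y)" by simp
  have ev: "\<forall>\<^sub>F z in nhds y. 0 = flat p z"
    using eventually_nhds_in_open[of "{..<0}" y] less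
    by (auto elim!: eventually_mono simp: flat_def)
  have "(flat p has_real_derivative 0) (at y)"
    by (rule iffD1[OF DERIV_cong_ev[OF refl ev refl] d])
  then show ?thesis using less by (simp add: flat_def)
next
  case equal
  have "((\<lambda>h. (flat p (0 + h) - flat p 0) / h) \<longlongrightarrow> 0) (at 0)"
    using flat_tendsto_0[of p] by (simp add: flat_def[of p 0])
  then have "(flat p has_real_derivative 0) (at 0)"
    by (simp add: DERIV_def)
  then show ?thesis using equal by (simp add: flat_def)
next
  case greater
  have d: "((\<lambda>z. poly p (inverse z) * exp (- inverse z)) has_real_derivative
      poly (flat_deriv p) (inverse y) * exp (- inverse y)) (at y)"
  proof -
    have inv: "(inverse has_real_derivative - (inverse y * inverse y)) (at y)"
      using DERIV_inverse[of y UNIV] greater by simp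
    have e: "((\<lambda>z. exp (- inverse z)) has_real_derivative exp (- inverse y) * (inverse y * inverse y)) (at y)"
      using DERIV_chain2[OF DERIV_exp DERIV_minus[OF inv]] by simp
    show ?thesis
      using DERIV_mult[OF DERIV_chain2[OF poly_DERIV inv] e]
      by (rule DERIV_cong) (simp add: flat_deriv_def algebra_simps)
  qed
  have ev: "\<forall>\<^sub>F z in nhds y. poly p (inverse z) * exp (- inverse z) = flat p z"
    using eventually_nhds_in_open[of "{0<..}" y] greater
    by (auto elim!: eventually_mono simp: flat_def)
  have "(flat p has_real_derivative
      poly (flat_deriv p) (inverse y) * exp (- inverse y)) (at y)"
    by (rule iffD1[OF DERIV_cong_ev[OF refl ev refl] d])
  then show ?thesis using greater by (simp add: flat_def)
qed

lemma smooth_flat: "smooth \<phi> \<Longrightarrow> smooth (\<lambda>x. flat 1 (\<phi> x))"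
  using smooth_comp[of \<phi> "\<lambda>n. flat ((flat_deriv ^^ n) 1)" 0] by (simp add: flat_has_derivative)

lemma flat_1_pos_iff: "flat 1 y > 0 \<longleftrightarrow> y > 0" and flat_1_nonneg: "flat 1 y \<ge> 0"
  by (auto simp: flat_def)

subsection \<open>Symmetry of mixed derivatives\<close>

lemma pd_along_line:
  assumes "smooth \<phi>"
  shows "((\<lambda>s. \<phi> (x + s *\<^sub>R axis i 1)) has_real_derivative pd i \<phi> (x + s *\<^sub>R axis i 1)) (at s)"
proof -
  let ?D = "frechet_derivative \<phi> (at (x + s *\<^sub>R axis i 1))"
  have D: "(\<phi> has_derivative ?D) (at (x + s *\<^sub>R axis i 1))"
    by (rule smooth_has_derivative[OF assms])
  have l: "((\<lambda>s. x + s *\<^sub>R axis i (1::real)) has_derivative (\<lambda>h. h *\<^sub>R axis i 1)) (at s)"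
    by (auto intro!: derivative_eq_intros)
  have "((\<lambda>s. \<phi> (x + s *\<^sub>R axis i 1)) has_derivative (\<lambda>h. ?D (h *\<^sub>R axis i 1))) (at s)"
    using has_derivative_compose[OF l D] .
  moreover have "?D (h *\<^sub>R axis i 1) = pd i \<phi> (x + s *\<^sub>R axis i 1) * h" for h
    using linear_scale[OF has_derivative_linear[OF D], of h "axis i 1"] by (simp add: pd_def)
  ultimately show ?thesis by (simp add: has_field_derivative_def)
qed

text \<open>The left-hand side is symmetric in \<open>i\<close> and \<open>j\<close>; the mean value theorem turns it into a mixed
  derivative at a nearby point, in either order.\<close>

lemma second_difference:
  assumes \<phi>: "smooth \<phi>" and h: "0 < h"
  obtains \<xi> \<eta> where "0 < \<xi>" "\<xi> < h" "0 < \<eta>" "\<eta> < h"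
    "\<phi> (x + h *\<^sub>R axis i 1 + h *\<^sub>R axis j 1) - \<phi> (x + h *\<^sub>R axis i 1) - \<phi> (x + h *\<^sub>R axis j 1) + \<phi> x
      = h\<^sup>2 * pd j (pd i \<phi>) (x + \<xi> *\<^sub>R axis i 1 + \<eta> *\<^sub>R axis j 1)"
proof -
  let ?e = "axis i 1 :: real^3" and ?d = "axis j 1 :: real^3"
  \<comment> \<open>The difference in direction \<open>j\<close>, as a function of the displacement in direction \<open>i\<close>.\<close>
  let ?g = "\<lambda>s. \<phi> ((x + h *\<^sub>R ?d) + s *\<^sub>R ?e) - \<phi> (x + s *\<^sub>R ?e)"
  let ?g' = "\<lambda>s. pd i \<phi> ((x + h *\<^sub>R ?d) + s *\<^sub>R ?e) - pd i \<phi> (x + s *\<^sub>R ?e)"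
  have "\<exists>z>0. z < h \<and> ?g h - ?g 0 = (h - 0) * ?g' z"
    by (rule MVT2[OF h]) (intro derivative_intros pd_along_line \<phi>)
  then obtain \<xi> where \<xi>: "0 < \<xi>" "\<xi> < h" "?g h - ?g 0 = h * ?g' \<xi>" by auto
  let ?f = "\<lambda>r. pd i \<phi> ((x + \<xi> *\<^sub>R ?e) + r *\<^sub>R ?d)"
  have "\<exists>z>0. z < h \<and> ?f h - ?f 0 = (h - 0) * pd j (pd i \<phi>) ((x + \<xi> *\<^sub>R ?e) + z *\<^sub>R ?d)"
    by (rule MVT2[OF h]) (intro pd_along_line smooth_pd \<phi>)
  then obtain \<eta> where \<eta>: "0 < \<eta>" "\<eta> < h"
    "?f h - ?f 0 = h * pd j (pd i \<phi>) ((x + \<xi> *\<^sub>R ?e) + \<eta> *\<^sub>R ?d)" by auto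
  have "?g' \<xi> = ?f h - ?f 0" by (simp add: algebra_simps)
  then have "?g h - ?g 0 = h\<^sup>2 * pd j (pd i \<phi>) (x + \<xi> *\<^sub>R ?e + \<eta> *\<^sub>R ?d)"
    using \<xi>(3) \<eta>(3) by (simp add: power2_eq_square)
  then show thesis
    using that[OF \<xi>(1,2) \<eta>(1,2)] by (simp add: algebra_simps)
qed

lemma pd_commute:
  assumes \<phi>: "smooth \<phi>"
  shows "pd i (pd j \<phi>) = pd j (pd i \<phi>)"
proof
  fix x :: "real^3"
  let ?a = "pd i (pd j \<phi>)" and ?b = "pd j (pd i \<phi>)"
  show "?a x = ?b x"
  proof (rule ccontr)
    assume ne: "?a x \<noteq> ?b x"
    define \<epsilon> where "\<epsilon> = \<bar>?a x - ?b x\<bar> / 2"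
    have "\<epsilon> > 0" using ne by (simp add: \<epsilon>_def)
    have ca: "isCont ?a x" and cb: "isCont ?b x"
      using \<phi> by (meson smooth_pd smooth_differentiable differentiable_imp_continuous_within)+
    obtain da where da: "da > 0" "\<And>y. dist y x < da \<Longrightarrow> dist (?a y) (?a x) < \<epsilon>"
      using ca \<open>\<epsilon> > 0\<close> unfolding continuous_at_eps_delta by blast
    obtain db where db: "db > 0" "\<And>y. dist y x < db \<Longrightarrow> dist (?b y) (?b x) < \<epsilon>"
      using cb \<open>\<epsilon> > 0\<close> unfolding continuous_at_eps_delta by blast
    define h where "h = min da db / 2"
    have h: "h > 0" "2 * h \<le> da" "2 * h \<le> db" using da db by (auto simp: h_def)
    have near: "dist (x + r *\<^sub>R axis k 1 + s *\<^sub>R axis l 1) x < 2 * h"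
      if "0 < r" "r < h" "0 < s" "s < h" for r s and k l :: 3
    proof -
      have "norm (r *\<^sub>R axis k (1::real) + s *\<^sub>R axis l 1) \<le> r + s"
        using that norm_triangle_ineq[of "r *\<^sub>R axis k (1::real)" "s *\<^sub>R axis l 1"] by simp
      then show ?thesis using that by (simp add: dist_norm add.assoc)
    qed
    obtain r s where 1: "0 < r" "r < h" "0 < s" "s < h"
      "\<phi> (x + h *\<^sub>R axis i 1 + h *\<^sub>R axis j 1) - \<phi> (x + h *\<^sub>R axis i 1) - \<phi> (x + h *\<^sub>R axis j 1) + \<phi> x
      = h\<^sup>2 * ?b (x + r *\<^sub>R axis i 1 + s *\<^sub>R axis j 1)"
      using second_difference[OF \<phi> h(1)] by blast
    obtain r' s' where 2: "0 < r'" "r' < h" "0 < s'" "s' < h"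
      "\<phi> (x + h *\<^sub>R axis j 1 + h *\<^sub>R axis i 1) - \<phi> (x + h *\<^sub>R axis j 1) - \<phi> (x + h *\<^sub>R axis i 1) + \<phi> x
      = h\<^sup>2 * ?a (x + r' *\<^sub>R axis j 1 + s' *\<^sub>R axis i 1)"
      using second_difference[OF \<phi> h(1)] by blast
    have "h\<^sup>2 * ?a (x + r' *\<^sub>R axis j 1 + s' *\<^sub>R axis i 1) = h\<^sup>2 * ?b (x + r *\<^sub>R axis i 1 + s *\<^sub>R axis j 1)"
    proof -
      have "x + h *\<^sub>R axis j 1 + h *\<^sub>R axis i 1 = x + h *\<^sub>R axis i 1 + h *\<^sub>R axis j 1"
        by simp
      note * = this
      show ?thesis using 1(5) 2(5) unfolding * by linarith
    qed
    then have "?a (x + r' *\<^sub>R axis j 1 + s' *\<^sub>R axis i 1) = ?b (x + r *\<^sub>R axis i 1 + s *\<^sub>R axis j 1)"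
      using h by simp
    moreover have "dist (?a (x + r' *\<^sub>R axis j 1 + s' *\<^sub>R axis i 1)) (?a x) < \<epsilon>"
      using near[OF 2(1-4), of j i] h by (intro da(2)) linarith
    moreover have "dist (?b (x + r *\<^sub>R axis i 1 + s *\<^sub>R axis j 1)) (?b x) < \<epsilon>"
      using near[OF 1(1-4), of i j] h by (intro db(2)) linarith
    ultimately show False unfolding \<epsilon>_def dist_real_def by argo
  qed
qed

section \<open>Test functions\<close>

lemma test_fun_smooth: "test_fun D \<phi> \<Longrightarrow> smooth \<phi>"
  by (cases D) simp_all

lemma region_open: "admissible D \<Longrightarrow> open (region D)"
  by (cases D) (simp_all add: lipschitz_domain_def open_box)

lemma region_bounded: "admissible D \<Longrightarrow> bounded (region D)"
  by (cases D) (simp_all add: lipschitz_domain_def bounded_box)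

lemma region_lmeasurable: "admissible D \<Longrightarrow> region D \<in> lmeasurable"
  by (simp add: region_open region_bounded lmeasurable_open)

lemma region_sets: "admissible D \<Longrightarrow> region D \<in> sets lebesgue"
  using region_lmeasurable fmeasurableD by blast

lemma pd_eq_0_outside_closure:
  assumes "x \<notin> closure {x. \<phi> x \<noteq> 0}"
  shows "pd i \<phi> x = 0"
proof -
  have "((\<lambda>_. 0) has_derivative (\<lambda>_. 0)) (at x)" by simp
  moreover have "open (- closure {x. \<phi> x \<noteq> 0})" "x \<in> - closure {x. \<phi> x \<noteq> 0}"
    using assms by auto
  moreover have "0 = \<phi> y" if "y \<in> - closure {x. \<phi> x \<noteq> 0}" for y
    using that closure_subset by force
  ultimately have "(\<phi> has_derivative (\<lambda>_. 0)) (at x)"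
    by (rule has_derivative_transform_within_open)
  from pd_eqI[OF this] show ?thesis .
qed

lemma compact_support_mono:
  assumes "compact (closure {x. \<phi> x \<noteq> 0})" "closure {x. \<phi> x \<noteq> 0} \<subseteq> U"
    and "{x. \<psi> x \<noteq> (0::real)} \<subseteq> closure {x. \<phi> x \<noteq> (0::real)}"
  shows "compact (closure {x. \<psi> x \<noteq> 0}) \<and> closure {x. \<psi> x \<noteq> 0} \<subseteq> U"
proof -
  have "closure {x. \<psi> x \<noteq> 0} \<subseteq> closure {x. \<phi> x \<noteq> 0}"
    using assms(3) closed_closure closure_minimal by blast
  then show ?thesis
    using assms(1,2) compact_Int_closed[OF assms(1) closed_closure, of "{x. \<psi> x \<noteq> 0}"]
    by (simp add: Int_absorb1)
qed

lemma test_fun_pd: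
  assumes "test_fun D \<phi>" shows "test_fun D (pd i \<phi>)"
proof (cases D)
  case (Periodic a b)
  have "pd i \<phi> (x + (b $ k - a $ k) *\<^sub>R axis k 1) = pd i \<phi> x" for k x
  proof -
    let ?c = "(b $ k - a $ k) *\<^sub>R axis k (1::real)"
    have s: "smooth \<phi>" and p: "\<And>x. \<phi> (x + ?c) = \<phi> x" using assms Periodic by auto
    have "((\<lambda>x. \<phi> (x + ?c)) has_derivative frechet_derivative \<phi> (at (x + ?c))) (at x)"
      using has_derivative_compose[OF has_derivative_add_const[OF has_derivative_ident]
          smooth_has_derivative[OF s, of "x + ?c"]] .
    then have "(\<phi> has_derivative frechet_derivative \<phi> (at (x + ?c))) (at x)"
      by (simp only: p)
    from pd_eqI[OF this] show ?thesis by (simp add: pd_def)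
  qed
  then show ?thesis using assms Periodic smooth_pd by simp
next
  case (Dirichlet \<Omega>)
  have "{x. pd i \<phi> x \<noteq> 0} \<subseteq> closure {x. \<phi> x \<noteq> 0}"
    using pd_eq_0_outside_closure by blast
  then show ?thesis
    using assms Dirichlet smooth_pd compact_support_mono[of \<phi> \<Omega> "pd i \<phi>"] by simp
qed

lemma test_fun_mult:
  assumes "test_fun D \<phi>" "test_fun D \<psi>" shows "test_fun D (\<lambda>x. \<phi> x * \<psi> x)"
proof (cases D)
  case (Periodic a b)
  then show ?thesis using assms smooth_mult by simp
next
  case (Dirichlet \<Omega>)
  have "{x. \<phi> x * \<psi> x \<noteq> 0} \<subseteq> closure {x. \<phi> x \<noteq> 0}"
    using closure_subset by fastforce
  then show ?thesis
    using assms Dirichlet smooth_mult compact_support_mono[of \<phi> \<Omega> "\<lambda>x. \<phi> x * \<psi> x"] by simp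
qed

lemma test_fun_bounded:
  assumes "admissible D" "test_fun D \<phi>"
  obtains B where "\<And>x. x \<in> region D \<Longrightarrow> \<bar>\<phi> x\<bar> \<le> B"
proof -
  have "compact (closure (region D))"
    using region_bounded[OF assms(1)] by (simp add: compact_closure)
  then have "compact (\<phi> ` closure (region D))"
    using compact_continuous_image smooth_continuous test_fun_smooth assms(2) by blast
  then obtain B where "\<And>y. y \<in> \<phi> ` closure (region D) \<Longrightarrow> norm y \<le> B"
    using compact_imp_bounded bounded_iff by metis
  then show thesis using that closure_subset[of "region D"] by force
qed

lemma test_fun_measurable:
  assumes "admissible D" "test_fun D \<phi>"
  shows "\<phi> \<in> borel_measurable (dom_measure D)"
  using assms region_sets smooth_continuous test_fun_smooth
  by (intro continuous_imp_measurable_on_sets_lebesgue) auto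

lemma loc_integrable_component:
  assumes "loc_integrable D (v :: real^3 \<Rightarrow> real^3)"
  shows "loc_integrable D (\<lambda>x. v x $ k)"
  using assms by (cases D)
    (auto intro!: integrable_bounded_linear[OF bounded_linear_vec_nth])

lemma integrable_lebesgue_on_subset:
  fixes f :: "real^3 \<Rightarrow> real"
  assumes "integrable (lebesgue_on S) f" "S \<subseteq> T" "S \<in> sets lebesgue" "T \<in> sets lebesgue"
    and "\<And>x. x \<in> T - S \<Longrightarrow> f x = 0"
  shows "integrable (lebesgue_on T) f"
proof -
  have "(\<lambda>x. indicator S x *\<^sub>R f x) = (\<lambda>x. indicator T x *\<^sub>R f x)"
    using assms(2,5) by (auto simp: fun_eq_iff indicator_def)
  then show ?thesis
    using assms(1,3,4) by (simp add: integrable_restrict_space)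
qed

text \<open>A test function localises: in the Dirichlet case \<open>f\<close> itself need not be integrable on \<open>\<Omega>\<close>.\<close>

lemma loc_integrable_mult_test:
  fixes f :: "real^3 \<Rightarrow> real"
  assumes D: "admissible D" and f: "loc_integrable D f" and \<phi>: "test_fun D \<phi>"
  shows "integrable (dom_measure D) (\<lambda>x. f x * \<phi> x)"
proof -
  obtain B where B: "\<And>x. x \<in> region D \<Longrightarrow> \<bar>\<phi> x\<bar> \<le> B"
    using test_fun_bounded[OF D \<phi>] by blast
  have *: "integrable (lebesgue_on S) (\<lambda>x. f x * \<phi> x)"
    if S: "integrable (lebesgue_on S) f" "S \<subseteq> region D" "S \<in> sets lebesgue" for S
  proof (rule Bochner_Integration.integrable_bound)
    show "integrable (lebesgue_on S) (\<lambda>x. B * f x)" using S by simp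
    have "\<phi> \<in> borel_measurable (lebesgue_on S)"
      using S(3) smooth_continuous test_fun_smooth \<phi>
      by (intro continuous_imp_measurable_on_sets_lebesgue) auto
    then show "(\<lambda>x. f x * \<phi> x) \<in> borel_measurable (lebesgue_on S)"
      using S(1) by measurable
    have "norm (f x * \<phi> x) \<le> norm (B * f x)" if "x \<in> S" for x
    proof -
      have "\<bar>\<phi> x\<bar> \<le> \<bar>B\<bar>" using B[of x] that S(2) by force
      then show ?thesis by (simp add: abs_mult mult.commute mult_right_mono)
    qed
    then show "AE x in lebesgue_on S. norm (f x * \<phi> x) \<le> norm (B * f x)"
      by (intro AE_I2) auto
  qed
  show ?thesis
  proof (cases D)
    case (Periodic a b)
    then show ?thesis using *[of "region D"] f region_sets[OF D] by simp
  next
    case (Dirichlet \<Omega>)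
    define K where "K = closure {x. \<phi> x \<noteq> 0}"
    have K: "compact K" "K \<subseteq> \<Omega>" using \<phi> Dirichlet by (auto simp: K_def)
    then have Ks: "K \<in> sets lebesgue" by (simp add: borel_compact)
    have "integrable (lebesgue_on K) (\<lambda>x. f x * \<phi> x)"
      using *[of K] f K Ks Dirichlet by simp
    moreover have "f x * \<phi> x = 0" if "x \<in> \<Omega> - K" for x
      using that closure_subset[of "{x. \<phi> x \<noteq> 0}"] by (auto simp: K_def)
    ultimately show ?thesis
      using integrable_lebesgue_on_subset[of K _ \<Omega>] K Ks region_sets[OF D] Dirichlet by simp
  qed
qed

section \<open>Integration by parts\<close>

text \<open>If the integral does not change under small translations of \<open>\<phi>\<close> in direction \<open>i\<close>,
  differentiation under the integral sign shows that the integral of \<open>pd i \<phi>\<close> vanishes.\<close>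

lemma integral_pd_eq_0:
  assumes \<phi>: "smooth \<phi>" and \<delta>: "\<delta> > 0"
    and const: "\<And>t. 0 \<le> t \<Longrightarrow> t \<le> \<delta> \<Longrightarrow>
      integral (cbox a b) (\<lambda>x. \<phi> (x + t *\<^sub>R axis i 1)) = integral (cbox a b) \<phi>"
  shows "integral (cbox a b) (pd i \<phi>) = 0"
proof -
  let ?e = "axis i 1 :: real^3"
  have "((\<lambda>t. integral (cbox a b) (\<lambda>x. \<phi> (x + t *\<^sub>R ?e))) has_field_derivative
      integral (cbox a b) (\<lambda>x. pd i \<phi> (x + 0 *\<^sub>R ?e))) (at 0 within cbox 0 \<delta>)"
  proof (rule leibniz_rule_field_derivative)
    show "((\<lambda>t. \<phi> (x + t *\<^sub>R ?e)) has_field_derivative pd i \<phi> (x + t *\<^sub>R ?e)) (at t within cbox 0 \<delta>)"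
      for t x
      using pd_along_line[OF \<phi>] has_field_derivative_at_within by blast
    show "(\<lambda>x. \<phi> (x + t *\<^sub>R ?e)) integrable_on cbox a b" for t
      by (intro integrable_continuous continuous_on_compose2[OF smooth_continuous[OF \<phi>, of UNIV]]
          continuous_intros) auto
    show "continuous_on (cbox 0 \<delta> \<times> cbox a b) (\<lambda>(t, x). pd i \<phi> (x + t *\<^sub>R ?e))"
      unfolding case_prod_unfold
      by (intro continuous_on_compose2[OF smooth_continuous[OF smooth_pd[OF \<phi>], of UNIV]]
          continuous_intros) auto
  qed (use \<delta> in auto)
  then have 1: "((\<lambda>t. integral (cbox a b) (\<lambda>x. \<phi> (x + t *\<^sub>R ?e))) has_vector_derivative
      integral (cbox a b) (pd i \<phi>)) (at 0 within cbox 0 \<delta>)"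
    by (simp add: has_real_derivative_iff_has_vector_derivative)
  have "((\<lambda>t. integral (cbox a b) \<phi>) has_vector_derivative 0) (at 0 within cbox 0 \<delta>)"
    by simp
  then have 2: "((\<lambda>t. integral (cbox a b) (\<lambda>x. \<phi> (x + t *\<^sub>R ?e))) has_vector_derivative 0)
      (at 0 within cbox 0 \<delta>)"
    by (rule has_vector_derivative_transform[rotated 2]) (use \<delta> const in auto)
  show ?thesis
    using vector_derivative_unique_within_closed_interval[OF \<delta> _ 1 2] \<delta> by simp
qed

text \<open>The union of the box and its translate by \<open>t\<close> is cut in two ways: into the box and a slab of
  thickness \<open>t\<close>, and into a slab of thickness \<open>t\<close> and the translated box. The two slabs differ by
  one period.\<close>

lemma integral_cbox_periodic_shift:
  fixes f :: "real^3 \<Rightarrow> real"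
  assumes cont: "continuous_on UNIV f" and L: "b $ i = a $ i + L" and t: "0 \<le> t" "t \<le> L"
    and per: "\<And>x. f (x + L *\<^sub>R axis i 1) = f x"
  shows "integral (cbox a b) (\<lambda>x. f (x + t *\<^sub>R axis i 1)) = integral (cbox a b) f"
proof -
  let ?e = "axis i 1 :: real^3"
  have e: "?e \<in> Basis" by (simp add: axis_in_Basis_iff)
  let ?Q = "cbox a (b + t *\<^sub>R ?e)"
  have fQ: "f integrable_on cbox c d" for c d
    using cont continuous_on_subset integrable_continuous by blast
  have split: "integral ?Q f = integral (?Q \<inter> {x. x \<bullet> ?e \<le> r}) f + integral (?Q \<inter> {x. x \<bullet> ?e \<ge> r}) f"
    for r
    using has_integral_split[OF integrable_integral integrable_integral e]
      integrable_split[OF fQ e] by blast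
  have 1: "?Q \<inter> {x. x \<bullet> ?e \<le> b $ i} = cbox a b"
    "?Q \<inter> {x. x \<bullet> ?e \<ge> b $ i} = cbox (a + L *\<^sub>R ?e) (b + t *\<^sub>R ?e)"
    "?Q \<inter> {x. x \<bullet> ?e \<le> a $ i + t} = cbox a (b + t *\<^sub>R ?e - L *\<^sub>R ?e)"
    "?Q \<inter> {x. x \<bullet> ?e \<ge> a $ i + t} = cbox (a + t *\<^sub>R ?e) (b + t *\<^sub>R ?e)"
  proof -
    \<comment> \<open>All boxes in sight differ only in their extent in direction \<open>i\<close>.\<close>
    define S where "S lo hi = {x. (\<forall>j. j \<noteq> i \<longrightarrow> a $ j \<le> x $ j \<and> x $ j \<le> b $ j) \<and> lo \<le> x $ i \<and> x $ i \<le> hi}"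
      for lo hi
    have box: "cbox (a + p *\<^sub>R ?e) (b + q *\<^sub>R ?e) = S (a $ i + p) (b $ i + q)" for p q
    proof (intro set_eqI iffI)
      fix x assume "x \<in> cbox (a + p *\<^sub>R ?e) (b + q *\<^sub>R ?e)"
      then have *: "a $ j + p * ?e $ j \<le> x $ j \<and> x $ j \<le> b $ j + q * ?e $ j" for j
        by (simp add: mem_box_cart)
      have "a $ j \<le> x $ j \<and> x $ j \<le> b $ j" if "j \<noteq> i" for j
        using *[of j] that by (simp add: axis_def)
      then show "x \<in> S (a $ i + p) (b $ i + q)"
        using *[of i] by (simp add: S_def)
    next
      fix x assume x: "x \<in> S (a $ i + p) (b $ i + q)"
      have "a $ j + p * ?e $ j \<le> x $ j \<and> x $ j \<le> b $ j + q * ?e $ j" for j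
        using x by (cases "j = i") (simp_all add: S_def axis_def)
      then show "x \<in> cbox (a + p *\<^sub>R ?e) (b + q *\<^sub>R ?e)"
        by (simp add: mem_box_cart)
    qed
    have "cbox a b = S (a $ i) (b $ i)" "?Q = S (a $ i) (b $ i + t)"
      "cbox a (b + t *\<^sub>R ?e - L *\<^sub>R ?e) = S (a $ i) (a $ i + t)"
      using box[of 0 0] box[of 0 t] box[of 0 "t - L"] L by (simp_all add: algebra_simps)
    moreover have "S lo hi \<inter> {x. x \<bullet> ?e \<le> r} = S lo r" if "r \<le> hi" for lo hi r
      using that by (auto simp: S_def inner_axis)
    moreover have "S lo hi \<inter> {x. x \<bullet> ?e \<ge> r} = S r hi" if "lo \<le> r" for lo hi r
      using that by (auto simp: S_def inner_axis)
    ultimately show "?Q \<inter> {x. x \<bullet> ?e \<le> b $ i} = cbox a b"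
      "?Q \<inter> {x. x \<bullet> ?e \<ge> b $ i} = cbox (a + L *\<^sub>R ?e) (b + t *\<^sub>R ?e)"
      "?Q \<inter> {x. x \<bullet> ?e \<le> a $ i + t} = cbox a (b + t *\<^sub>R ?e - L *\<^sub>R ?e)"
      "?Q \<inter> {x. x \<bullet> ?e \<ge> a $ i + t} = cbox (a + t *\<^sub>R ?e) (b + t *\<^sub>R ?e)"
      using t L by (simp_all add: box)
  qed
  have "integral (cbox (a + L *\<^sub>R ?e) (b + t *\<^sub>R ?e)) f
      = integral (cbox a (b + t *\<^sub>R ?e - L *\<^sub>R ?e)) f"
    using integral_shift_cbox[of "a + L *\<^sub>R ?e" "L *\<^sub>R ?e" "b + t *\<^sub>R ?e" f] per by simp
  then have "integral (cbox (a + t *\<^sub>R ?e) (b + t *\<^sub>R ?e)) f = integral (cbox a b) f"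
    using split[of "b $ i"] split[of "a $ i + t"] unfolding 1 by simp
  then show ?thesis
    using integral_shift_cbox[of "a + t *\<^sub>R ?e" "t *\<^sub>R ?e" "b + t *\<^sub>R ?e" f] by simp
qed

lemma integral_test_pd:
  assumes D: "admissible D" and \<phi>: "test_fun D \<phi>"
  shows "(\<integral>x. pd i \<phi> x \<partial>dom_measure D) = 0"
proof -
  have s: "smooth \<phi>" using \<phi> by (rule test_fun_smooth)
  obtain B where B: "\<And>x. x \<in> region D \<Longrightarrow> \<bar>pd i \<phi> x\<bar> \<le> B"
    using test_fun_bounded[OF D test_fun_pd[OF \<phi>]] by blast
  have "integrable (dom_measure D) (pd i \<phi>)"
  proof (rule finite_measure.integrable_const_bound[OF finite_measure_lebesgue_on])
    show "region D \<in> lmeasurable" by (rule region_lmeasurable[OF D])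
    show "AE x in dom_measure D. norm (pd i \<phi> x) \<le> B" 
        by (intro AE_I2) (use B in auto)
  qed (rule test_fun_measurable[OF D test_fun_pd[OF \<phi>]])
  then have HK: "(\<integral>x. pd i \<phi> x \<partial>dom_measure D) = integral (region D) (pd i \<phi>)"
    by (rule lebesgue_integral_eq_integral) (rule region_sets[OF D])
  show ?thesis
  proof (cases D)
    case (Periodic a b)
    have "integral (cbox a b) (pd i \<phi>) = 0"
    proof (rule integral_pd_eq_0[OF s])
      show "b $ i - a $ i > 0" using D Periodic by simp
      show "integral (cbox a b) (\<lambda>x. \<phi> (x + t *\<^sub>R axis i 1)) = integral (cbox a b) \<phi>"
        if "0 \<le> t" "t \<le> b $ i - a $ i" for t
        using \<phi> Periodic that
        by (intro integral_cbox_periodic_shift[where L = "b $ i - a $ i"] smooth_continuous[OF s]) auto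
    qed
    then show ?thesis using HK Periodic by (simp add: integral_open_interval)
  next
    case (Dirichlet \<Omega>)
    define K where "K = closure {x. \<phi> x \<noteq> 0}"
    have K: "compact K" "K \<subseteq> \<Omega>" using \<phi> Dirichlet by (auto simp: K_def)
    have restr: "integral S f = integral K f" if "K \<subseteq> S" "\<And>x. x \<notin> K \<Longrightarrow> f x = 0"
      for S and f :: "real^3 \<Rightarrow> real"
    proof -
      have "f = (\<lambda>x. if x \<in> K then f x else 0)" using that(2) by auto
      then have "integral S f = integral S (\<lambda>x. if x \<in> K then f x else 0)" by metis
      also have "\<dots> = integral (K \<inter> S) f" by (rule integral_restrict_Int)
      finally show ?thesis using that(1) by (simp add: Int_absorb2)
    qed
    obtain r where r: "\<And>x. x \<in> K \<Longrightarrow> norm x \<le> r"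
      using K(1) compact_imp_bounded bounded_iff by metis
    \<comment> \<open>The margin \<open>1\<close> keeps the support inside the box under translations by \<open>t \<le> 1\<close>.\<close>
    obtain a b where ab: "cball (0::real^3) (r + 1) \<subseteq> cbox a b"
      using bounded_subset_cbox_symmetric[OF bounded_cball] by metis
    have sub: "K \<subseteq> cbox (a + t *\<^sub>R axis i 1) (b + t *\<^sub>R axis i 1)" if "0 \<le> t" "t \<le> 1" for t
    proof
      fix x assume "x \<in> K"
      have "norm (x - t *\<^sub>R axis i 1) \<le> norm x + norm (t *\<^sub>R axis i (1::real) :: real^3)"
        by (rule norm_triangle_ineq4)
      also have "\<dots> \<le> r + 1" using r[OF \<open>x \<in> K\<close>] that by simp
      finally have "x - t *\<^sub>R axis i 1 \<in> cbox a b" using ab by auto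
      then show "x \<in> cbox (a + t *\<^sub>R axis i 1) (b + t *\<^sub>R axis i 1)"
        by (auto simp: mem_box_cart algebra_simps)
    qed
    have z: "\<phi> x = 0" if "x \<notin> K" for x
      using that closure_subset[of "{x. \<phi> x \<noteq> 0}"] by (auto simp: K_def)
    have "integral (cbox a b) (pd i \<phi>) = 0"
    proof (rule integral_pd_eq_0[OF s zero_less_one])
      fix t :: real assume t: "0 \<le> t" "t \<le> 1"
      have "integral (cbox a b) (\<lambda>x. \<phi> (x + t *\<^sub>R axis i 1))
          = integral (cbox (a + t *\<^sub>R axis i 1) (b + t *\<^sub>R axis i 1)) \<phi>"
        using integral_shift_cbox[of "a + t *\<^sub>R axis i 1" "t *\<^sub>R axis i 1" "b + t *\<^sub>R axis i 1" \<phi>]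
        by simp
      also have "\<dots> = integral (cbox a b) \<phi>"
        using restr[OF sub[OF t] z] restr[OF _ z, of "cbox a b"] sub[of 0] by simp
      finally show "integral (cbox a b) (\<lambda>x. \<phi> (x + t *\<^sub>R axis i 1)) = integral (cbox a b) \<phi>" .
    qed
    moreover have "pd i \<phi> x = 0" if "x \<notin> K" for x
      using that pd_eq_0_outside_closure by (auto simp: K_def)
    ultimately show ?thesis
      using HK Dirichlet restr[of \<Omega> "pd i \<phi>"] restr[of "cbox a b" "pd i \<phi>"] K sub[of 0] by simp
  qed
qed

lemma integral_by_parts_test:
  assumes D: "admissible D" and \<phi>: "test_fun D \<phi>" and \<psi>: "test_fun D \<psi>"
  shows "(\<integral>x. pd i \<phi> x * \<psi> x \<partial>dom_measure D) = - (\<integral>x. \<phi> x * pd i \<psi> x \<partial>dom_measure D)"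
proof -
  have i: "integrable (dom_measure D) (\<lambda>x. f x * g x)" if f: "test_fun D f" and g: "test_fun D g" for f g
  proof -
    obtain B where B: "\<And>x. x \<in> region D \<Longrightarrow> \<bar>f x * g x\<bar> \<le> B"
      using test_fun_bounded[OF D test_fun_mult[OF f g]] by blast
    show ?thesis
    proof (rule finite_measure.integrable_const_bound[OF finite_measure_lebesgue_on])
      show "region D \<in> lmeasurable" by (rule region_lmeasurable[OF D])
      show "AE x in dom_measure D. norm (f x * g x) \<le> B" 
        by (intro AE_I2) (use B in auto)
    qed (rule test_fun_measurable[OF D test_fun_mult[OF f g]])
  qed
  have "pd i (\<lambda>x. \<phi> x * \<psi> x) = (\<lambda>x. \<phi> x * pd i \<psi> x + pd i \<phi> x * \<psi> x)"
    using pd_mult smooth_differentiable test_fun_smooth \<phi> \<psi> by blast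
  then have "(\<integral>x. \<phi> x * pd i \<psi> x + pd i \<phi> x * \<psi> x \<partial>dom_measure D) = 0"
    using integral_test_pd[OF D test_fun_mult[OF \<phi> \<psi>], of i] by simp
  then show ?thesis
    using i[OF \<phi> test_fun_pd[OF \<psi>]] i[OF test_fun_pd[OF \<phi>] \<psi>] by simp
qed

section \<open>The fundamental lemma of the calculus of variations\<close>

text \<open>At almost every point, \<open>f\<close> is the limit of its averages over small cubes.\<close>

lemma AE_zero_if_box_integrals_zero:
  fixes f :: "real^3 \<Rightarrow> real"
  assumes U: "open U"
    and int: "\<And>c d. cbox c d \<subseteq> U \<Longrightarrow> integrable (lebesgue_on (cbox c d)) f"
    and zero: "\<And>c d. cbox c d \<subseteq> U \<Longrightarrow> integral (cbox c d) f = 0"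
  shows "AE x in lebesgue_on U. f x = 0"
proof -
  obtain \<D> where \<D>: "countable \<D>" "\<D> \<subseteq> Pow U" "\<And>X. X \<in> \<D> \<Longrightarrow> \<exists>a b. X = cbox a b" "\<Union>\<D> = U"
    using open_countable_Union_open_cbox[OF U] by metis
  have "\<exists>N. negligible N \<and> (\<forall>x\<in>X - N. f x = 0)" if X: "X \<in> \<D>" for X
  proof -
    obtain a b where ab: "X = cbox a b" using \<D>(3)[OF X] by blast
    have abU: "cbox a b \<subseteq> U" using \<D>(2) X ab by blast
    define g where "g x = (if x \<in> cbox a b then f x else 0)" for x
    have "g integrable_on cbox p q" for p q
    proof -
      obtain c d where cd: "cbox p q \<inter> cbox a b = cbox c d"
        using Int_interval by blast
      then have "cbox c d \<subseteq> U" using abU by blast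
      then have "f integrable_on cbox c d"
        using int integrable_on_lebesgue_on by (metis lmeasurable_cbox fmeasurableD)
      then show ?thesis
        using cd integrable_restrict_Int[of "cbox a b" f "cbox p q"] unfolding g_def
        by (simp add: Int_commute)
    qed
    then obtain N where N: "negligible N"
      "\<And>x e. x \<notin> N \<Longrightarrow> 0 < e \<Longrightarrow> \<exists>d>0. \<forall>h. 0 < h \<and> h < d \<longrightarrow>
         norm (integral (cbox x (x + h *\<^sub>R One)) g /\<^sub>R h ^ DIM(real^3) - g x) < e"
      using integrable_ccontinuous_explicit[of g] by metis
    have "f x = 0" if x: "x \<in> box a b" "x \<notin> N" for x
    proof (rule ccontr)
      assume "f x \<noteq> 0"
      have gx: "g x = f x" using x box_subset_cbox[of a b] by (auto simp: g_def)
      obtain \<delta> where \<delta>: "\<delta> > 0" "\<And>h. 0 < h \<Longrightarrow> h < \<delta> \<Longrightarrow>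
         norm (integral (cbox x (x + h *\<^sub>R One)) g /\<^sub>R h ^ DIM(real^3) - g x) < norm (f x)"
        using N(2)[OF x(2), of "norm (f x)"] \<open>f x \<noteq> 0\<close> by auto
      have "((\<lambda>h. x + h *\<^sub>R One) \<longlongrightarrow> x + 0 *\<^sub>R One) (at_right 0)"
        by (intro tendsto_intros)
      then have "\<forall>\<^sub>F h in at_right 0. x + h *\<^sub>R One \<in> box a b"
        using topological_tendstoD[OF _ open_box[of a b]] x by simp
      moreover have "\<forall>\<^sub>F h in at_right 0. h < \<delta> \<and> 0 < h"
        using \<delta>(1) eventually_at_right_less[of "0::real"] eventually_conj
          eventually_at_right_field by (metis (mono_tags, lifting))
      ultimately have "\<forall>\<^sub>F h in at_right 0. x + h *\<^sub>R One \<in> box a b \<and> h < \<delta> \<and> 0 < h"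
        by (rule eventually_conj)
      then obtain h where h: "x + h *\<^sub>R One \<in> box a b" "h < \<delta>" "0 < h"
        using eventually_happens trivial_limit_at_right_real by blast
      have sub: "cbox x (x + h *\<^sub>R One) \<subseteq> cbox a b"
      proof -
        have "cbox x z \<subseteq> cbox a b" if "x \<in> cbox a b" "z \<in> cbox a b" for z
          using that unfolding subset_eq Ball_def mem_box_cart by (meson order_trans)
        then show ?thesis using x h box_subset_cbox[of a b] by blast
      qed
      have "integral (cbox x (x + h *\<^sub>R One)) g = integral (cbox x (x + h *\<^sub>R One)) f"
        by (rule integral_cong) (use sub in \<open>auto simp: g_def\<close>)
      also have "\<dots> = 0" using zero sub abU by blast
      finally show False using \<delta>(2)[OF h(3,2)] gx by simp
    qed
    moreover have "negligible (cbox a b - box a b)"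
      using negligible_frontier_interval by blast
    ultimately have "negligible (N \<union> (cbox a b - box a b)) \<and>
        (\<forall>x\<in>X - (N \<union> (cbox a b - box a b)). f x = 0)"
      using N(1) negligible_Un ab by blast
    then show ?thesis by blast
  qed
  then obtain N where N: "\<And>X. X \<in> \<D> \<Longrightarrow> negligible (N X)" "\<And>X x. X \<in> \<D> \<Longrightarrow> x \<in> X - N X \<Longrightarrow> f x = 0"
    by metis
  have "negligible (\<Union>X\<in>\<D>. N X)"
    using negligible_countable_Union[of "N ` \<D>"] \<D>(1) N(1) by auto
  then have "AE x in lebesgue. x \<notin> (\<Union>X\<in>\<D>. N X)"
    using negligible_iff_null_sets AE_not_in by blast
  then have "AE x in lebesgue. x \<in> U \<longrightarrow> f x = 0"
    by (rule AE_mp) (use N(2) \<D>(4) in \<open>auto intro!: AE_I2\<close>)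
  then show ?thesis
    using U by (simp add: AE_restrict_space_iff)
qed

text \<open>As \<open>n\<close> grows, the test functions \<open>1 - exp (- n \<psi>)\<close> increase on the domain to the indicator function
  of the open box.\<close>

lemma test_fun_bump:
  assumes D: "admissible D" and cd: "cbox c d \<subseteq> region D" "box c d \<noteq> {}"
  obtains \<psi> where "\<And>n. test_fun D (\<lambda>x. 1 - exp (- real n * \<psi> x))" "\<And>x. \<psi> x \<ge> 0"
    "\<And>x. x \<in> region D \<Longrightarrow> \<psi> x > 0 \<longleftrightarrow> x \<in> box c d"
proof -
  have prod_pos: "(\<Prod>k\<in>UNIV. flat 1 (\<theta> k)) > 0 \<longleftrightarrow> (\<forall>k. \<theta> k > 0)" for \<theta> :: "3 \<Rightarrow> real"
  proof
    show "\<forall>k. \<theta> k > 0" if "(\<Prod>k\<in>UNIV. flat 1 (\<theta> k)) > 0"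
    proof
      fix k
      have "flat 1 (\<theta> k) \<noteq> 0" using that by (metis UNIV_I finite_class.finite_UNIV less_irrefl prod_zero)
      then show "\<theta> k > 0" using flat_1_nonneg[of "\<theta> k"] flat_1_pos_iff[of "\<theta> k"] by linarith
    qed
  qed (simp add: prod_pos flat_1_pos_iff)
  have sm: "smooth (\<lambda>x. 1 - exp (- real n * (\<Prod>k\<in>UNIV. flat 1 (\<theta> k x))))"
    if "\<And>k. smooth (\<theta> k)" for \<theta> :: "3 \<Rightarrow> real^3 \<Rightarrow> real" and n
    using that by (intro smooth_diff smooth_const smooth_exp smooth_mult smooth_prod smooth_flat) simp_all
  have cd': "c $ k < d $ k" for k
    using cd(2) by (auto simp: box_ne_empty Basis_vec_def inner_axis)
  show thesis
  proof (cases D)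
    case (Periodic a b)
    \<comment> \<open>A shift by the period changes the sign of both sines.\<close>
    define \<theta> where "\<theta> k x = sin (pi / (b $ k - a $ k) * (x $ k - c $ k)) *
      sin (pi / (b $ k - a $ k) * (d $ k - x $ k))" for k and x :: "real^3"
    have ab: "a $ k < b $ k" for k using D Periodic by simp
    have "c \<in> cbox c d" "d \<in> cbox c d" using cd' by (auto simp: mem_box_cart less_imp_le)
    then have "c \<in> box a b" "d \<in> box a b" using cd(1) Periodic by auto
    then have in_ab: "a $ k < c $ k" "d $ k < b $ k" "a $ k < d $ k" "c $ k < b $ k" for k
      by (simp_all add: mem_box_cart)
    have sin_pos: "sin (pi / L * y) > 0 \<longleftrightarrow> y > 0" "sin (pi / L * y) < 0 \<longleftrightarrow> y < 0"
      if "- L < y" "y < L" for L y :: real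
    proof -
      have L: "L > 0" using that by simp
      have b: "- pi < pi / L * y" "pi / L * y < pi"
        using mult_strict_left_mono[OF that(1), of "pi / L"] mult_strict_left_mono[OF that(2), of "pi / L"] L
        by simp_all
      have s: "pi / L * y > 0 \<longleftrightarrow> y > 0" "pi / L * y < 0 \<longleftrightarrow> y < 0" "pi / L * y = 0 \<longleftrightarrow> y = 0"
        using L by (simp_all add: zero_less_mult_iff mult_less_0_iff zero_less_divide_iff divide_less_0_iff)
      show "sin (pi / L * y) > 0 \<longleftrightarrow> y > 0" "sin (pi / L * y) < 0 \<longleftrightarrow> y < 0"
        using s b sin_gt_zero[of "pi / L * y"] sin_gt_zero[of "- (pi / L * y)"]
        by (cases y "0::real" rule: linorder_cases; simp)+
    qed
    have pos: "\<theta> k x > 0 \<longleftrightarrow> c $ k < x $ k \<and> x $ k < d $ k" if "x \<in> box a b" for k x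
    proof -
      have "a $ k < x $ k" "x $ k < b $ k" using that by (auto simp: mem_box_cart)
      then have r: "- (b $ k - a $ k) < x $ k - c $ k" "x $ k - c $ k < b $ k - a $ k"
        "- (b $ k - a $ k) < d $ k - x $ k" "d $ k - x $ k < b $ k - a $ k"
        using in_ab[of k] by linarith+
      show ?thesis
        unfolding \<theta>_def zero_less_mult_iff sin_pos[OF r(1,2)] sin_pos[OF r(3,4)]
        using cd'[of k] by auto
    qed
    have per: "\<theta> k (x + (b $ i - a $ i) *\<^sub>R axis i 1) = \<theta> k x" for k i x
    proof (cases "k = i")
      case True
      have "pi / (b $ i - a $ i) * ((x $ i + (b $ i - a $ i)) - c $ i)
          = pi / (b $ i - a $ i) * (x $ i - c $ i) + pi"
        "pi / (b $ i - a $ i) * (d $ i - (x $ i + (b $ i - a $ i)))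
          = pi / (b $ i - a $ i) * (d $ i - x $ i) - pi"
        using ab[of i] by (simp_all add: field_simps)
      then show ?thesis
        using True unfolding \<theta>_def by (simp add: axis_def sin_diff)
    next
      case False
      then show ?thesis by (simp add: \<theta>_def axis_def)
    qed
    have "smooth (\<theta> k)" for k
      unfolding \<theta>_def by (intro smooth_mult smooth_sin smooth_diff smooth_coord smooth_const)
    from sm[OF this] have "test_fun D (\<lambda>x. 1 - exp (- real n * (\<Prod>k\<in>UNIV. flat 1 (\<theta> k x))))" for n
      by (simp add: Periodic per)
    moreover have "(\<Prod>k\<in>UNIV. flat 1 (\<theta> k x)) \<ge> 0" for x
      by (simp add: prod_nonneg flat_1_nonneg)
    moreover have "(\<Prod>k\<in>UNIV. flat 1 (\<theta> k x)) > 0 \<longleftrightarrow> x \<in> box c d" if "x \<in> region D" for x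
      using that Periodic pos by (simp add: prod_pos mem_box_cart)
    ultimately show thesis by (rule that)
  next
    case (Dirichlet \<Omega>)
    define \<theta> where "\<theta> k x = (x $ k - c $ k) * (d $ k - x $ k)" for k and x :: "real^3"
    let ?\<psi> = "\<lambda>x. \<Prod>k\<in>UNIV. flat 1 (\<theta> k x)"
    have pos: "?\<psi> x > 0 \<longleftrightarrow> x \<in> box c d" for x
    proof -
      have "\<theta> k x > 0 \<longleftrightarrow> c $ k < x $ k \<and> x $ k < d $ k" for k
        using cd'[of k] unfolding \<theta>_def zero_less_mult_iff by auto
      then show ?thesis by (simp add: prod_pos mem_box_cart)
    qed
    have nn: "?\<psi> x \<ge> 0" for x by (simp add: prod_nonneg flat_1_nonneg)
    have tf: "test_fun D (\<lambda>x. 1 - exp (- real n * ?\<psi> x))" for n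
    proof -
      have "{x. 1 - exp (- real n * ?\<psi> x) \<noteq> 0} \<subseteq> box c d"
      proof
        fix x assume "x \<in> {x. 1 - exp (- real n * ?\<psi> x) \<noteq> 0}"
        then have "?\<psi> x \<noteq> 0" by auto
        then show "x \<in> box c d" using pos[of x] nn[of x] by linarith
      qed
      then have sub: "closure {x. 1 - exp (- real n * ?\<psi> x) \<noteq> 0} \<subseteq> cbox c d"
        by (meson box_subset_cbox closed_cbox closure_minimal order_trans)
      then have "compact (closure {x. 1 - exp (- real n * ?\<psi> x) \<noteq> 0})"
        using bounded_cbox bounded_subset compact_eq_bounded_closed closed_closure by metis
      moreover have "smooth (\<theta> k)" for k
        unfolding \<theta>_def by (intro smooth_mult smooth_diff smooth_coord smooth_const)
      ultimately show ?thesis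
        using sm[of \<theta> n] sub cd(1) Dirichlet by simp
    qed
    show thesis by (rule that[of ?\<psi>, OF tf nn pos])
  qed
qed

lemma loc_integrable_on_cbox:
  fixes f :: "real^3 \<Rightarrow> real"
  assumes D: "admissible D" and f: "loc_integrable D f" and cd: "cbox c d \<subseteq> region D"
  shows "integrable (lebesgue_on (cbox c d)) f"
proof (cases D)
  case (Periodic a b)
  then have "set_integrable lebesgue (box a b) f"
    using f by (simp add: set_integrable_def integrable_restrict_space)
  then have "set_integrable lebesgue (cbox c d) f"
    by (rule set_integrable_subset) (use cd Periodic in auto)
  then show ?thesis by (simp add: set_integrable_def integrable_restrict_space)
next
  case (Dirichlet \<Omega>)
  then show ?thesis using f cd by simp
qed

lemma fundamental_lemma:
  fixes f :: "real^3 \<Rightarrow> real"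
  assumes D: "admissible D" and f: "loc_integrable D f"
    and zero: "\<And>\<phi>. test_fun D \<phi> \<Longrightarrow> (\<integral>x. f x * \<phi> x \<partial>dom_measure D) = 0"
  shows "AE x in dom_measure D. f x = 0"
proof (rule AE_zero_if_box_integrals_zero[OF region_open[OF D] loc_integrable_on_cbox[OF D f]])
  fix c d assume cd: "cbox c d \<subseteq> region D"
  show "integral (cbox c d) f = 0"
  proof (cases "box c d = {}")
    case True
    then show ?thesis by (metis integral_open_interval integral_empty)
  next
    case False
    obtain \<psi> where \<psi>: "\<And>n. test_fun D (\<lambda>x. 1 - exp (- real n * \<psi> x))" "\<And>x. \<psi> x \<ge> 0"
      "\<And>x. x \<in> region D \<Longrightarrow> \<psi> x > 0 \<longleftrightarrow> x \<in> box c d"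
      using test_fun_bump[OF D cd False] by blast
    let ?s = "\<lambda>n x. f x * (1 - exp (- real n * \<psi> x))"
    let ?g = "\<lambda>x. if x \<in> box c d then f x else 0"
    have sets: "box c d \<in> sets lebesgue" "cbox c d \<in> sets lebesgue" by auto
    have boxD: "box c d \<subseteq> region D" using cd box_subset_cbox by blast
    have "set_integrable lebesgue (box c d) f"
    proof (rule set_integrable_subset)
      show "set_integrable lebesgue (cbox c d) f"
        using loc_integrable_on_cbox[OF D f cd]
        by (simp add: set_integrable_def integrable_restrict_space)
    qed (auto simp: box_subset_cbox)
    then have "integrable (lebesgue_on (box c d)) f"
      by (simp add: set_integrable_def integrable_restrict_space)
    then have "integrable (lebesgue_on (box c d)) ?g"
      by (rule Bochner_Integration.integrable_cong[THEN iffD1, rotated 2]) auto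
    then have g: "integrable (dom_measure D) ?g"
      by (rule integrable_lebesgue_on_subset[OF _ boxD sets(1) region_sets[OF D]]) auto
    have "(\<lambda>n. integral\<^sup>L (dom_measure D) (?s n)) \<longlonglongrightarrow> integral\<^sup>L (dom_measure D) ?g"
    proof (rule integral_dominated_convergence)
      show "integrable (dom_measure D) (\<lambda>x. \<bar>?g x\<bar>)" using g by (rule integrable_abs)
      show "?g \<in> borel_measurable (dom_measure D)" using g by simp
      show "?s n \<in> borel_measurable (dom_measure D)" for n
        using loc_integrable_mult_test[OF D f \<psi>(1)] by blast
      show "AE x in dom_measure D. (\<lambda>n. ?s n x) \<longlonglongrightarrow> ?g x"
      proof (rule AE_I2)
        fix x assume "x \<in> space (dom_measure D)"
        then have x: "x \<in> region D" by simp
        show "(\<lambda>n. ?s n x) \<longlonglongrightarrow> ?g x"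
        proof (cases "x \<in> box c d")
          case True
          then have "exp (- \<psi> x) < 1" using \<psi>(3)[OF x] by simp
          then have "(\<lambda>n. exp (- \<psi> x) ^ n) \<longlonglongrightarrow> 0" by (intro LIMSEQ_realpow_zero) simp_all
          then have "(\<lambda>n. f x * (1 - exp (- \<psi> x) ^ n)) \<longlonglongrightarrow> f x * (1 - 0)"
            by (rule tendsto_mult[OF tendsto_const tendsto_diff[OF tendsto_const]])
          then show ?thesis using True by (simp add: exp_of_nat_mult[symmetric] del: power_tendsto_0_iff)
        next
          case False
          then have "\<psi> x = 0" using \<psi>(3)[OF x] \<psi>(2)[of x] by simp
          then show ?thesis using False by simp
        qed
      qed
      show "AE x in dom_measure D. norm (?s n x) \<le> \<bar>?g x\<bar>" for n
      proof (rule AE_I2)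
        fix x assume "x \<in> space (dom_measure D)"
        then have x: "x \<in> region D" by simp
        have "0 < exp (- real n * \<psi> x)" "exp (- real n * \<psi> x) \<le> 1"
          using \<psi>(2)[of x] by (simp_all add: mult_nonneg_nonneg)
        then have "\<bar>1 - exp (- real n * \<psi> x)\<bar> \<le> 1" by linarith
        then have "\<bar>f x\<bar> * \<bar>1 - exp (- real n * \<psi> x)\<bar> \<le> \<bar>f x\<bar>"
          by (simp add: mult_left_le)
        moreover have "\<psi> x = 0" if "x \<notin> box c d"
          using that \<psi>(3)[OF x] \<psi>(2)[of x] by simp
        ultimately show "norm (?s n x) \<le> \<bar>?g x\<bar>" by (simp add: abs_mult)
      qed
    qed
    then have "integral\<^sup>L (dom_measure D) ?g = 0"
      using zero[OF \<psi>(1)] by (simp add: LIMSEQ_const_iff)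
    moreover have "integral\<^sup>L (dom_measure D) ?g = integral (region D) ?g"
      by (rule lebesgue_integral_eq_integral[OF g region_sets[OF D]])
    moreover have "\<dots> = integral (box c d) f"
      using integral_restrict_Int[of "region D" "box c d" f] boxD by (simp add: Int_absorb2)
    ultimately show ?thesis by (simp add: integral_open_interval)
  qed
qed

section \<open>Square integrable functions\<close>

lemma square_integrable_inner:
  assumes "square_integrable D f" "square_integrable D g"
  shows "integrable (dom_measure D) (\<lambda>x. f x \<bullet> g x)"
proof (rule Bochner_Integration.integrable_bound)
  show "integrable (dom_measure D) (\<lambda>x. (norm (f x))\<^sup>2 + (norm (g x))\<^sup>2)"
    using assms by (simp add: square_integrable_def)
  show "(\<lambda>x. f x \<bullet> g x) \<in> borel_measurable (dom_measure D)"
    using assms by (auto simp: square_integrable_def)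
  show "AE x in dom_measure D. norm (f x \<bullet> g x) \<le> norm ((norm (f x))\<^sup>2 + (norm (g x))\<^sup>2)"
  proof (rule AE_I2)
    fix x
    have "norm (f x \<bullet> g x) \<le> norm (f x) * norm (g x)"
      by (simp add: Cauchy_Schwarz_ineq2)
    also have "\<dots> \<le> (norm (f x))\<^sup>2 + (norm (g x))\<^sup>2"
    proof -
      have "0 \<le> norm (f x) * norm (g x)" by simp
      then show ?thesis using sum_squares_bound[of "norm (f x)" "norm (g x)"] by linarith
    qed
    finally show "norm (f x \<bullet> g x) \<le> norm ((norm (f x))\<^sup>2 + (norm (g x))\<^sup>2)" by simp
  qed
qed

lemma square_integrable_scale:
  "square_integrable D f \<Longrightarrow> square_integrable D (\<lambda>x. c *\<^sub>R f x)"
  by (auto simp: square_integrable_def power_mult_distrib)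

lemma square_integrable_add:
  assumes "square_integrable D f" "square_integrable D g"
  shows "square_integrable D (\<lambda>x. f x + g x)"
proof -
  have "(norm (f x + g x))\<^sup>2 = (norm (f x))\<^sup>2 + 2 * (f x \<bullet> g x) + (norm (g x))\<^sup>2" for x
    by (simp add: power2_norm_eq_inner inner_add_left inner_add_right inner_commute)
  then show ?thesis
    using assms square_integrable_inner[OF assms] by (auto simp: square_integrable_def)
qed

lemma square_integrable_diff:
  assumes "square_integrable D f" "square_integrable D g"
  shows "square_integrable D (\<lambda>x. f x - g x)"
  using square_integrable_add[OF assms(1) square_integrable_scale[OF assms(2), of "-1"]] by simp

lemma square_integrable_sum:
  "finite F \<Longrightarrow> (\<And>k. k \<in> F \<Longrightarrow> square_integrable D (f k)) \<Longrightarrow>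
    square_integrable D (\<lambda>x. \<Sum>k\<in>F. f k x)"
  by (induction F rule: finite_induct)
    (simp_all add: square_integrable_add, simp add: square_integrable_def)

lemma square_integrable_component:
  assumes "square_integrable D (v :: real^3 \<Rightarrow> real^3)"
  shows "square_integrable D (\<lambda>x. v x $ k)"
proof -
  have m: "(\<lambda>x. v x $ k) \<in> borel_measurable (dom_measure D)"
  proof -
    have "v \<in> borel_measurable (dom_measure D)"
      using assms by (simp add: square_integrable_def)
    then have "(\<lambda>x. v x \<bullet> axis k 1) \<in> borel_measurable (dom_measure D)" by measurable
    then show ?thesis by (simp add: inner_axis)
  qed
  have "integrable (dom_measure D) (\<lambda>x. (norm (v x $ k))\<^sup>2)"
  proof (rule Bochner_Integration.integrable_bound)
    show "integrable (dom_measure D) (\<lambda>x. (norm (v x))\<^sup>2)"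
      using assms by (simp add: square_integrable_def)
    show "(\<lambda>x. (norm (v x $ k))\<^sup>2) \<in> borel_measurable (dom_measure D)" using m by measurable
    show "AE x in dom_measure D. norm ((norm (v x $ k))\<^sup>2) \<le> norm ((norm (v x))\<^sup>2)"
    proof (rule AE_I2)
      fix x
      have "\<bar>v x $ k\<bar>\<^sup>2 \<le> (norm (v x))\<^sup>2"
        by (intro power_mono component_le_norm_cart) simp
      then show "norm ((norm (v x $ k))\<^sup>2) \<le> norm ((norm (v x))\<^sup>2)" by simp
    qed
  qed
  then show ?thesis using m by (simp add: square_integrable_def)
qed

lemma square_integrable_bounded:
  assumes D: "admissible D" and f: "f \<in> borel_measurable (dom_measure D)"
    and B: "\<And>x. x \<in> region D \<Longrightarrow> norm (f x) \<le> B"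
  shows "square_integrable D f"
proof -
  have "integrable (dom_measure D) (\<lambda>x. (norm (f x))\<^sup>2)"
  proof (rule finite_measure.integrable_const_bound[OF finite_measure_lebesgue_on])
    show "region D \<in> lmeasurable" by (rule region_lmeasurable[OF D])
    show "AE x in dom_measure D. norm ((norm (f x))\<^sup>2) \<le> B\<^sup>2"
      by (intro AE_I2) (use B in \<open>auto intro: power_mono\<close>)
  qed (use f in measurable)
  then show ?thesis using f by (simp add: square_integrable_def)
qed

lemma square_integrable_test_fun:
  assumes D: "admissible D" and \<phi>: "test_fun D \<phi>"
  shows "square_integrable D \<phi>"
  using square_integrable_bounded[OF D test_fun_measurable[OF D \<phi>]] test_fun_bounded[OF D \<phi>]
  by (metis real_norm_def)

lemma square_integrable_grad_test_fun:
  assumes D: "admissible D" and \<phi>: "test_fun D \<phi>"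
  shows "square_integrable D (\<lambda>x. (\<chi> i. pd i \<phi> x) :: real^3)"
proof -
  have s: "square_integrable D (pd i \<phi>)" for i
    using square_integrable_test_fun[OF D test_fun_pd[OF \<phi>]] .
  have e: "(norm ((\<chi> i. pd i \<phi> x) :: real^3))\<^sup>2 = (\<Sum>i\<in>UNIV. (norm (pd i \<phi> x))\<^sup>2)" for x
    unfolding power2_norm_eq_inner inner_vec_def by (simp add: power2_eq_square)
  have "(\<lambda>x. (\<chi> i. pd i \<phi> x) :: real^3) \<in> borel_measurable (dom_measure D)"
  proof (rule borel_measurable_euclidean_space[THEN iffD2], intro ballI)
    fix b :: "real^3" assume "b \<in> Basis"
    then obtain i where b: "b = axis i 1" by (auto simp: Basis_vec_def)
    show "(\<lambda>x. ((\<chi> i. pd i \<phi> x) :: real^3) \<bullet> b) \<in> borel_measurable (dom_measure D)"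
      using test_fun_measurable[OF D test_fun_pd[OF \<phi>]] by (simp add: b inner_axis)
  qed
  then show ?thesis
    using s by (simp add: square_integrable_def e)
qed

lemma square_integrable_imp_integrable:
  assumes D: "admissible D" and f: "square_integrable D f"
  shows "integrable (dom_measure D) f"
proof (rule Bochner_Integration.integrable_bound)
  interpret finite_measure "dom_measure D"
    by (rule finite_measure_lebesgue_on[OF region_lmeasurable[OF D]])
  show "integrable (dom_measure D) (\<lambda>x. 1 + (norm (f x))\<^sup>2)"
    using f by (simp add: square_integrable_def)
  show "f \<in> borel_measurable (dom_measure D)"
    using f by (simp add: square_integrable_def)
  have "y \<le> 1 + y\<^sup>2" for y :: real
    using zero_le_power2[of "y - 1/2"] by (simp add: power2_eq_square algebra_simps)
  then show "AE x in dom_measure D. norm (f x) \<le> norm (1 + (norm (f x))\<^sup>2)"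
    by (intro AE_I2) (simp add: order_trans[OF _ abs_ge_self])
qed

lemma square_integrable_imp_loc_integrable:
  assumes D: "admissible D" and f: "square_integrable D f"
  shows "loc_integrable D f"
proof (cases D)
  case (Periodic a b)
  then show ?thesis using square_integrable_imp_integrable[OF D f] by simp
next
  case (Dirichlet \<Omega>)
  have "integrable (lebesgue_on K) f" if K: "compact K" "K \<subseteq> \<Omega>" for K
  proof -
    have s: "K \<in> sets lebesgue" using K by (simp add: borel_compact)
    have "set_integrable lebesgue \<Omega> f"
      using square_integrable_imp_integrable[OF D f] region_sets[OF D] Dirichlet
      by (simp add: set_integrable_def integrable_restrict_space)
    then have "set_integrable lebesgue K f"
      by (rule set_integrable_subset) (use s K in auto)
    then show ?thesis using s by (simp add: set_integrable_def integrable_restrict_space)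
  qed
  then show ?thesis using Dirichlet by simp
qed

lemma l2_norm_power2:
  "(l2_norm D f)\<^sup>2 = (\<integral>x. (norm (f x))\<^sup>2 \<partial>dom_measure D)"
  by (simp add: l2_norm_def)

lemma l2_norm_nonneg: "l2_norm D f \<ge> 0"
  by (simp add: l2_norm_def)

lemma l2_Cauchy_Schwarz:
  assumes f: "square_integrable D f" and g: "square_integrable D g"
  shows "\<bar>\<integral>x. f x \<bullet> g x \<partial>dom_measure D\<bar> \<le> l2_norm D f * l2_norm D g"
proof -
  define A B C where "A = (l2_norm D f)\<^sup>2" and "B = (\<integral>x. f x \<bullet> g x \<partial>dom_measure D)"
    and "C = (l2_norm D g)\<^sup>2"
  \<comment> \<open>This is the squared norm of \<open>f - t g\<close>; it is smallest at \<open>t = B / C\<close>, unless \<open>C = 0\<close>.\<close>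
  have q: "0 \<le> A - 2 * t * B + t\<^sup>2 * C" for t
  proof -
    have "(norm (f x - t *\<^sub>R g x))\<^sup>2 = (norm (f x))\<^sup>2 - (2 * t) * (f x \<bullet> g x) + t\<^sup>2 * (norm (g x))\<^sup>2" for x
      unfolding power2_norm_eq_inner
      by (simp add: inner_diff_left inner_diff_right inner_commute power2_eq_square algebra_simps)
    then have "(\<integral>x. (norm (f x - t *\<^sub>R g x))\<^sup>2 \<partial>dom_measure D) = A - 2 * t * B + t\<^sup>2 * C"
      using f g square_integrable_inner[OF f g]
      by (simp add: A_def B_def C_def l2_norm_power2 square_integrable_def)
    moreover have "0 \<le> (\<integral>x. (norm (f x - t *\<^sub>R g x))\<^sup>2 \<partial>dom_measure D)"
      by (intro Bochner_Integration.integral_nonneg) simp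
    ultimately show ?thesis by simp
  qed
  have AC: "A \<ge> 0" "C \<ge> 0" by (simp_all add: A_def C_def)
  have "B\<^sup>2 \<le> A * C"
  proof (cases "C = 0")
    case True
    have "B = 0"
    proof (rule ccontr)
      assume "B \<noteq> 0"
      then show False using q[of "(A + 1) / (2 * B)"] True AC by simp
    qed
    then show ?thesis using True by simp
  next
    case False
    then have "C > 0" using AC by simp
    then show ?thesis
      using q[of "B / C"] by (simp add: power2_eq_square field_simps)
  qed
  then have "\<bar>B\<bar> \<le> sqrt (A * C)" by (metis real_sqrt_abs real_sqrt_le_iff)
  then show ?thesis by (simp add: A_def B_def C_def real_sqrt_mult l2_norm_nonneg)
qed

lemma l2_norm_triangle:
  assumes f: "square_integrable D f" and g: "square_integrable D g"
  shows "l2_norm D (\<lambda>x. f x + g x) \<le> l2_norm D f + l2_norm D g"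
proof (rule power2_le_imp_le)
  have "(norm (f x + g x))\<^sup>2 = (norm (f x))\<^sup>2 + 2 * (f x \<bullet> g x) + (norm (g x))\<^sup>2" for x
    by (simp add: power2_norm_eq_inner inner_add_left inner_add_right inner_commute)
  then have "(l2_norm D (\<lambda>x. f x + g x))\<^sup>2
      = (l2_norm D f)\<^sup>2 + 2 * (\<integral>x. f x \<bullet> g x \<partial>dom_measure D) + (l2_norm D g)\<^sup>2"
    using f g square_integrable_inner[OF f g]
    by (simp add: l2_norm_power2 square_integrable_def)
  then show "(l2_norm D (\<lambda>x. f x + g x))\<^sup>2 \<le> (l2_norm D f + l2_norm D g)\<^sup>2"
    using l2_Cauchy_Schwarz[OF f g] by (simp add: power2_sum)
qed (simp add: l2_norm_nonneg)

lemma l2_norm_scale: "l2_norm D (\<lambda>x. c *\<^sub>R f x) = \<bar>c\<bar> * l2_norm D f"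
  by (simp add: l2_norm_def power_mult_distrib real_sqrt_mult)

lemma l2_norm_cong_AE:
  assumes f: "square_integrable D f" and g: "square_integrable D g"
    and eq: "AE x in dom_measure D. f x = g x"
  shows "l2_norm D f = l2_norm D g"
proof -
  have "(\<integral>x. (norm (f x))\<^sup>2 \<partial>dom_measure D) = (\<integral>x. (norm (g x))\<^sup>2 \<partial>dom_measure D)"
  proof (rule integral_cong_AE)
    show "AE x in dom_measure D. (norm (f x))\<^sup>2 = (norm (g x))\<^sup>2"
      using eq by eventually_elim simp
  qed (use f g in \<open>auto simp: square_integrable_def dest: borel_measurable_integrable\<close>)
  then show ?thesis by (simp add: l2_norm_def)
qed

lemma l2_norm_eq_0_imp_AE:
  assumes f: "square_integrable D f" and z: "l2_norm D f = 0"
  shows "AE x in dom_measure D. f x = 0"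
proof -
  have "(\<integral>x. (norm (f x))\<^sup>2 \<partial>dom_measure D) = 0"
    using z l2_norm_power2[of D f] by simp
  then have "AE x in dom_measure D. (norm (f x))\<^sup>2 = 0"
    using f by (subst (asm) integral_nonneg_eq_0_iff_AE) (auto simp: square_integrable_def)
  then show ?thesis by simp
qed

lemma tendsto_l2_inner:
  assumes f: "\<And>n. square_integrable D (f n)" "square_integrable D f0" and g: "square_integrable D g"
    and lim: "(\<lambda>n. l2_norm D (\<lambda>x. f n x - f0 x)) \<longlonglongrightarrow> 0"
  shows "(\<lambda>n. \<integral>x. f n x \<bullet> g x \<partial>dom_measure D) \<longlonglongrightarrow> (\<integral>x. f0 x \<bullet> g x \<partial>dom_measure D)"
proof (rule LIM_zero_cancel, rule Lim_null_comparison)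
  have "(\<integral>x. f n x \<bullet> g x \<partial>dom_measure D) - (\<integral>x. f0 x \<bullet> g x \<partial>dom_measure D)
      = (\<integral>x. (f n x - f0 x) \<bullet> g x \<partial>dom_measure D)" for n
    using square_integrable_inner[OF f(1) g] square_integrable_inner[OF f(2) g]
    by (simp add: inner_diff_left)
  then show "\<forall>\<^sub>F n in sequentially. norm ((\<integral>x. f n x \<bullet> g x \<partial>dom_measure D)
      - (\<integral>x. f0 x \<bullet> g x \<partial>dom_measure D)) \<le> l2_norm D (\<lambda>x. f n x - f0 x) * l2_norm D g"
    using l2_Cauchy_Schwarz[OF square_integrable_diff[OF f(1) f(2)] g] by simp
  show "(\<lambda>n. l2_norm D (\<lambda>x. f n x - f0 x) * l2_norm D g) \<longlonglongrightarrow> 0"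
    using tendsto_mult_left_zero[OF lim] .
qed

section \<open>The Dirichlet form\<close>

text \<open>\<open>G\<close> is a square integrable weak gradient of \<open>f\<close>, and it may replace the gradient of a test
  function in Green's formula: if \<open>h = - div H\<close> in the sense of distributions, then the pairing of
  \<open>h\<close> with \<open>f\<close> is that of \<open>H\<close> with \<open>G\<close>, without a boundary term.\<close>

definition is_H1_grad :: "flow_domain \<Rightarrow> (real^3 \<Rightarrow> real) \<Rightarrow> (real^3 \<Rightarrow> real^3) \<Rightarrow> bool" where
  "is_H1_grad D f G \<longleftrightarrow> square_integrable D G \<and> has_weak_grad D f G \<and>
     (\<forall>h H. square_integrable D h \<longrightarrow> square_integrable D H \<longrightarrow>
       (\<forall>\<phi>. test_fun D \<phi> \<longrightarrow> (\<integral>x. h x * \<phi> x \<partial>dom_measure D)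
          = (\<integral>x. H x \<bullet> (\<chi> i. pd i \<phi> x) \<partial>dom_measure D)) \<longrightarrow>
       (\<integral>x. h x * f x \<partial>dom_measure D) = (\<integral>x. H x \<bullet> G x \<partial>dom_measure D))"

text \<open>The gradient of a function in \<open>H1_bc\<close>: a representative of a class up to null sets.\<close>

definition H1_grad :: "flow_domain \<Rightarrow> (real^3 \<Rightarrow> real) \<Rightarrow> real^3 \<Rightarrow> real^3" where
  "H1_grad D f = (SOME G. is_H1_grad D f G)"

lemma is_H1_grad_exists:
  assumes D: "admissible D" and f: "f \<in> H1_bc D"
  shows "\<exists>G. is_H1_grad D f G"
proof -
  obtain G \<phi> where G: "square_integrable D (G :: real^3 \<Rightarrow> real^3)" and \<phi>: "\<And>n. test_fun D (\<phi> n)"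
    and lim: "(\<lambda>n. l2_norm D (\<lambda>x. \<phi> n x - f x)) \<longlonglongrightarrow> 0"
    "(\<lambda>n. l2_norm D (\<lambda>x. (\<chi> i. pd i (\<phi> n) x) - G x)) \<longlonglongrightarrow> 0" and sf: "square_integrable D f"
    using f unfolding H1_bc_def by blast
  note s\<phi> = square_integrable_test_fun[OF D \<phi>] and sg = square_integrable_grad_test_fun[OF D \<phi>]
  have wg: "has_weak_grad D f G"
    unfolding has_weak_grad_def has_weak_pd_def
  proof (intro allI conjI impI)
    fix i \<psi> assume \<psi>: "test_fun D \<psi>"
    have p: "square_integrable D (pd i \<psi>)"
      using square_integrable_test_fun[OF D test_fun_pd[OF \<psi>]] .
    have e: "square_integrable D (\<lambda>x. axis i (\<psi> x) :: real^3)"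
    proof -
      have "axis i (\<psi> x) = \<psi> x *\<^sub>R (axis i 1 :: real^3)" for x
        by (simp add: vec_eq_iff axis_def)
      then show ?thesis
        using square_integrable_test_fun[OF D \<psi>]
        by (auto simp: square_integrable_def intro: borel_measurable_scaleR)
    qed
    have "(\<lambda>n. \<integral>x. \<phi> n x \<bullet> pd i \<psi> x \<partial>dom_measure D) \<longlonglongrightarrow> (\<integral>x. f x \<bullet> pd i \<psi> x \<partial>dom_measure D)"
      by (rule tendsto_l2_inner[OF s\<phi> sf p lim(1)])
    then have "(\<lambda>n. - (\<integral>x. \<phi> n x * pd i \<psi> x \<partial>dom_measure D)) \<longlonglongrightarrow> - (\<integral>x. f x * pd i \<psi> x \<partial>dom_measure D)"
      by (intro tendsto_minus) simp
    then have 1: "(\<lambda>n. \<integral>x. pd i (\<phi> n) x * \<psi> x \<partial>dom_measure D) \<longlonglongrightarrow> - (\<integral>x. f x * pd i \<psi> x \<partial>dom_measure D)"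
      by (simp add: integral_by_parts_test[OF D \<phi> \<psi>])
    have 2: "(\<lambda>n. \<integral>x. pd i (\<phi> n) x * \<psi> x \<partial>dom_measure D) \<longlonglongrightarrow> (\<integral>x. G x $ i * \<psi> x \<partial>dom_measure D)"
      using tendsto_l2_inner[OF sg G e lim(2)] by (simp add: inner_axis)
    show "(\<integral>x. G x $ i * \<psi> x \<partial>dom_measure D) = - (\<integral>x. f x * pd i \<psi> x \<partial>dom_measure D)"
      by (rule LIMSEQ_unique[OF 2 1])
  qed (use square_integrable_imp_loc_integrable[OF D] sf square_integrable_component[OF G] in auto)
  have "(\<integral>x. h x * f x \<partial>dom_measure D) = (\<integral>x. H x \<bullet> G x \<partial>dom_measure D)"
    if h: "square_integrable D h" and H: "square_integrable D H"
      and eq: "\<And>\<phi>. test_fun D \<phi> \<Longrightarrow> (\<integral>x. h x * \<phi> x \<partial>dom_measure D)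
          = (\<integral>x. H x \<bullet> (\<chi> i. pd i \<phi> x) \<partial>dom_measure D)" for h H
  proof (rule LIMSEQ_unique)
    show "(\<lambda>n. \<integral>x. h x * \<phi> n x \<partial>dom_measure D) \<longlonglongrightarrow> (\<integral>x. h x * f x \<partial>dom_measure D)"
      using tendsto_l2_inner[OF s\<phi> sf h lim(1)] by (simp add: mult.commute)
    show "(\<lambda>n. \<integral>x. h x * \<phi> n x \<partial>dom_measure D) \<longlonglongrightarrow> (\<integral>x. H x \<bullet> G x \<partial>dom_measure D)"
      using tendsto_l2_inner[OF sg G H lim(2)] by (simp add: eq[OF \<phi>] inner_commute)
  qed
  note green = this
  show ?thesis
    unfolding is_H1_grad_def
  proof (intro exI[of _ G] conjI allI impI)
    fix h H assume h: "square_integrable D h" and H: "square_integrable D H"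
      and eq: "\<forall>\<phi>. test_fun D \<phi> \<longrightarrow> (\<integral>x. h x * \<phi> x \<partial>dom_measure D)
          = (\<integral>x. H x \<bullet> (\<chi> i. pd i \<phi> x) \<partial>dom_measure D)"
    show "(\<integral>x. h x * f x \<partial>dom_measure D) = (\<integral>x. H x \<bullet> G x \<partial>dom_measure D)"
      by (rule green[OF h H eq[rule_format]])
  qed (fact G wg)+
qed

lemma A_graph_sq:
  assumes "A_graph D v h"
  shows "square_integrable D v" "square_integrable D h"
  using assms by (auto simp: A_graph_def L2_fields_def)

lemma weak_grad_laplacian:
  assumes D: "admissible D" and G: "has_weak_grad D f G"
    and \<phi>: "test_fun D \<phi>"
  shows "- (\<integral>x. f x * (\<Sum>i\<in>UNIV. pd i (pd i \<phi>) x) \<partial>dom_measure D)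
    = (\<integral>x. G x \<bullet> (\<chi> i. pd i \<phi> x) \<partial>dom_measure D)"
proof -
  have l: "loc_integrable D f" "\<And>i. loc_integrable D (\<lambda>x. G x $ i)"
    using G by (auto simp: has_weak_grad_def has_weak_pd_def)
  have "- (\<integral>x. f x * (\<Sum>i\<in>UNIV. pd i (pd i \<phi>) x) \<partial>dom_measure D)
      = - (\<Sum>i\<in>UNIV. \<integral>x. f x * pd i (pd i \<phi>) x \<partial>dom_measure D)"
    using loc_integrable_mult_test[OF D l(1)] test_fun_pd \<phi>
    by (subst Bochner_Integration.integral_sum[symmetric]) (auto simp: sum_distrib_left)
  also have "\<dots> = (\<Sum>i\<in>UNIV. \<integral>x. G x $ i * pd i \<phi> x \<partial>dom_measure D)"
  proof -
    have "(\<integral>x. G x $ i * pd i \<phi> x \<partial>dom_measure D) = - (\<integral>x. f x * pd i (pd i \<phi>) x \<partial>dom_measure D)" for i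
      using G test_fun_pd[OF \<phi>] unfolding has_weak_grad_def has_weak_pd_def by blast
    then show ?thesis by (simp add: sum_negf)
  qed
  also have "\<dots> = (\<integral>x. G x \<bullet> (\<chi> i. pd i \<phi> x) \<partial>dom_measure D)"
    using loc_integrable_mult_test[OF D l(2)] test_fun_pd \<phi>
    by (subst Bochner_Integration.integral_sum[symmetric]) (auto simp: inner_vec_def)
  finally show ?thesis .
qed

lemma H1_grad:
  assumes D: "admissible D" and f: "f \<in> H1_bc D"
  shows "square_integrable D (H1_grad D f)" "has_weak_grad D f (H1_grad D f)"
    "\<And>h H. square_integrable D h \<Longrightarrow> square_integrable D H \<Longrightarrow>
       (\<And>\<phi>. test_fun D \<phi> \<Longrightarrow> (\<integral>x. h x * \<phi> x \<partial>dom_measure D)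
          = (\<integral>x. H x \<bullet> (\<chi> i. pd i \<phi> x) \<partial>dom_measure D)) \<Longrightarrow>
       (\<integral>x. h x * f x \<partial>dom_measure D) = (\<integral>x. H x \<bullet> H1_grad D f x \<partial>dom_measure D)"
proof -
  have *: "is_H1_grad D f (H1_grad D f)"
    unfolding H1_grad_def by (rule someI_ex[OF is_H1_grad_exists[OF D f]])
  note * = this[unfolded is_H1_grad_def]
  show "square_integrable D (H1_grad D f)" using * by (rule conjunct1)
  show "has_weak_grad D f (H1_grad D f)" using *[THEN conjunct2] by (rule conjunct1)
  show "(\<integral>x. h x * f x \<partial>dom_measure D) = (\<integral>x. H x \<bullet> H1_grad D f x \<partial>dom_measure D)"
    if "square_integrable D h" "square_integrable D H"
       "\<And>\<phi>. test_fun D \<phi> \<Longrightarrow> (\<integral>x. h x * \<phi> x \<partial>dom_measure D)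
          = (\<integral>x. H x \<bullet> (\<chi> i. pd i \<phi> x) \<partial>dom_measure D)" for h H
    using *[THEN conjunct2, THEN conjunct2, rule_format, OF that(1,2)] that(3) by blast
qed

lemma A_graph_H1: "A_graph D v h \<Longrightarrow> (\<lambda>x. v x $ k) \<in> H1_bc D"
  by (simp add: A_graph_def)

text \<open>\<open>A\<close> is represented by the Dirichlet form on \<open>H1_bc\<close>.\<close>

lemma A_graph_Dirichlet_form:
  assumes D: "admissible D" and v: "A_graph D v h" and e: "square_integrable D e" "\<And>k. (\<lambda>x. e x $ k) \<in> H1_bc D"
  shows "l2_inner D h e
    = (\<Sum>k\<in>UNIV. \<integral>x. H1_grad D (\<lambda>y. v y $ k) x \<bullet> H1_grad D (\<lambda>y. e y $ k) x \<partial>dom_measure D)"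
proof -
  note sq = square_integrable_component[OF A_graph_sq(1)[OF v]]
    square_integrable_component[OF A_graph_sq(2)[OF v]] square_integrable_component[OF e(1)]
  note Hv = H1_grad[OF D A_graph_H1[OF v]]
  have *: "(\<integral>x. h x $ k * e x $ k \<partial>dom_measure D)
      = (\<integral>x. H1_grad D (\<lambda>y. v y $ k) x \<bullet> H1_grad D (\<lambda>y. e y $ k) x \<partial>dom_measure D)" for k
  proof (rule H1_grad(3)[OF D e(2) sq(2) Hv(1)])
    fix \<phi> assume \<phi>: "test_fun D \<phi>"
    show "(\<integral>x. h x $ k * \<phi> x \<partial>dom_measure D)
        = (\<integral>x. H1_grad D (\<lambda>y. v y $ k) x \<bullet> (\<chi> i. pd i \<phi> x) \<partial>dom_measure D)"
      using weak_grad_laplacian[OF D Hv(2) \<phi>] v \<phi> by (simp add: A_graph_def)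
  qed
  have "l2_inner D h e = (\<Sum>k\<in>UNIV. \<integral>x. h x $ k * e x $ k \<partial>dom_measure D)"
    using square_integrable_inner[OF sq(2,3)]
    by (simp add: l2_inner_def inner_vec_def)
  then show ?thesis by (simp add: *)
qed

lemma l2_inner_commute: "l2_inner D v w = l2_inner D w v"
  by (simp add: l2_inner_def inner_commute)

lemma A_graph_symmetric:
  assumes D: "admissible D" and v: "A_graph D v h" and e: "A_graph D e g"
  shows "l2_inner D h e = l2_inner D v g"
  unfolding l2_inner_commute[of D v g]
    A_graph_Dirichlet_form[OF D v A_graph_sq(1)[OF e] A_graph_H1[OF e]]
    A_graph_Dirichlet_form[OF D e A_graph_sq(1)[OF v] A_graph_H1[OF v]]
  by (simp add: inner_commute)

lemma A_graph_nonneg: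
  assumes D: "admissible D" and v: "A_graph D v h"
  shows "l2_inner D h v \<ge> 0"
  unfolding A_graph_Dirichlet_form[OF D v A_graph_sq(1)[OF v] A_graph_H1[OF v]]
  by (intro sum_nonneg Bochner_Integration.integral_nonneg) simp

section \<open>The curl of the curl\<close>

lemma has_weak_pd_loc_integrable:
  assumes "has_weak_pd D i f f'"
  shows "loc_integrable D f" "loc_integrable D f'"
  using assms by (simp_all add: has_weak_pd_def)

text \<open>The curl is a combination of the weak partial derivatives of the components.\<close>

lemma curl_exists:
  assumes D: "admissible D" and v: "square_integrable D v" "\<And>k. (\<lambda>x. v x $ k) \<in> H1_bc D"
  shows "has_curl D v (curl D v)"
proof -
  let ?G = "\<lambda>k. H1_grad D (\<lambda>y. v y $ k)"
  let ?w = "\<lambda>x. vector [?G 3 x $ 2 - ?G 2 x $ 3, ?G 1 x $ 3 - ?G 3 x $ 1, ?G 2 x $ 1 - ?G 1 x $ 2] :: real^3"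
  have sG: "square_integrable D (\<lambda>x. ?G k x $ i)" for k i
    using square_integrable_component[OF H1_grad(1)[OF D v(2)]] .
  have wp: "has_weak_pd D i (\<lambda>x. v x $ k) (\<lambda>x. ?G k x $ i)" for k i
    using H1_grad(2)[OF D v(2)] by (simp add: has_weak_grad_def)
  have lG: "loc_integrable D (\<lambda>x. ?G k x $ i)" for k i
    by (rule has_weak_pd_loc_integrable(2)[OF wp])
  have lv: "loc_integrable D (\<lambda>x. v x $ k)" for k
    by (rule has_weak_pd_loc_integrable(1)[OF wp])
  have "square_integrable D ?w"
  proof -
    have s: "square_integrable D (\<lambda>x. ?w x $ k)" for k
      using exhaust_3[of k] by (auto intro: square_integrable_diff[OF sG sG])
    have m: "(\<lambda>x. ?w x) \<in> borel_measurable (dom_measure D)"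
    proof (rule borel_measurable_euclidean_space[THEN iffD2], intro ballI)
      fix b :: "real^3" assume "b \<in> Basis"
      then obtain i where b: "b = axis i 1" by (auto simp: Basis_vec_def)
      show "(\<lambda>x. ?w x \<bullet> b) \<in> borel_measurable (dom_measure D)"
        using s[of i] by (simp add: b inner_axis square_integrable_def)
    qed
    have e: "(norm (?w x))\<^sup>2 = (\<Sum>i\<in>UNIV. (norm (?w x $ i))\<^sup>2)" for x
      unfolding power2_norm_eq_inner inner_vec_def by (simp add: power2_eq_square)
    show ?thesis using m s unfolding square_integrable_def e by simp
  qed
  moreover have "(\<integral>x. (?G k x $ i - ?G l x $ j) * \<phi> x \<partial>dom_measure D)
      = - (\<integral>x. v x $ k * pd i \<phi> x - v x $ l * pd j \<phi> x \<partial>dom_measure D)"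
    if \<phi>: "test_fun D \<phi>" for k i l j \<phi>
    using wp \<phi> loc_integrable_mult_test[OF D lG \<phi>]
      loc_integrable_mult_test[OF D lv test_fun_pd[OF \<phi>]]
    by (simp add: has_weak_pd_def left_diff_distrib)
  ultimately have "has_curl D v ?w"
    unfolding has_curl_def
    using square_integrable_imp_loc_integrable[OF D v(1)] square_integrable_imp_loc_integrable[OF D, of ?w]
    by simp
  then show ?thesis unfolding curl_def by (rule someI[of "has_curl D v"])
qed

lemma curl_unique:
  assumes D: "admissible D" and w: "has_curl D v w" and w': "has_curl D v w'"
  shows "AE x in dom_measure D. w x = w' x"
proof -
  have l: "loc_integrable D (\<lambda>x. w x $ k)" "loc_integrable D (\<lambda>x. w' x $ k)" for k
    using w w' by (simp_all add: has_curl_def loc_integrable_component del: loc_integrable.simps)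
  have "AE x in dom_measure D. w x $ k - w' x $ k = 0" for k
  proof (rule fundamental_lemma[OF D])
    show "loc_integrable D (\<lambda>x. w x $ k - w' x $ k)"
      using l[of k] by (cases D) auto
    fix \<phi> assume \<phi>: "test_fun D \<phi>"
    have "(\<integral>x. w x $ k * \<phi> x \<partial>dom_measure D) = (\<integral>x. w' x $ k * \<phi> x \<partial>dom_measure D)"
      using w w' \<phi> exhaust_3[of k] by (auto simp: has_curl_def)
    then show "(\<integral>x. (w x $ k - w' x $ k) * \<phi> x \<partial>dom_measure D) = 0"
      using loc_integrable_mult_test[OF D l(1) \<phi>] loc_integrable_mult_test[OF D l(2) \<phi>]
      by (simp add: left_diff_distrib)
  qed
  then have "AE x in dom_measure D. \<forall>k. w x $ k - w' x $ k = 0"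
    by (simp add: AE_all_countable)
  then show ?thesis by (simp add: vec_eq_iff)
qed

text \<open>\<open>curl (curl v) = grad (div v) - \<Delta>v\<close>, in the sense of distributions. No integrability of the
  derivatives of \<open>w\<close> is needed, since both curls can be moved onto the test function.\<close>

lemma curl_curl:
  assumes D: "admissible D" and v: "A_graph D v h" and div: "div_free D v" and w: "has_curl D v w"
  shows "has_curl D w h"
proof -
  have lv: "loc_integrable D (\<lambda>x. v x $ k)" and lw: "loc_integrable D (\<lambda>x. w x $ k)" for k
    using w by (simp_all add: has_curl_def loc_integrable_component)
  have h: "loc_integrable D h"
    by (rule square_integrable_imp_loc_integrable[OF D A_graph_sq(2)[OF v]])
  \<comment> \<open>The second derivative \<open>\<partial>\<^sub>i \<partial>\<^sub>j\<close> of the component \<open>v\<^sub>k\<close>, paired with \<open>\<phi>\<close>.\<close>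
  define J where "J \<phi> k i j = (\<integral>x. v x $ k * pd i (pd j \<phi>) x \<partial>dom_measure D)" for \<phi> k i j
  have goal: "(\<integral>x. h x $ 1 * \<phi> x \<partial>dom_measure D) = - (\<integral>x. w x $ 3 * pd 2 \<phi> x - w x $ 2 * pd 3 \<phi> x \<partial>dom_measure D)"
    "(\<integral>x. h x $ 2 * \<phi> x \<partial>dom_measure D) = - (\<integral>x. w x $ 1 * pd 3 \<phi> x - w x $ 3 * pd 1 \<phi> x \<partial>dom_measure D)"
    "(\<integral>x. h x $ 3 * \<phi> x \<partial>dom_measure D) = - (\<integral>x. w x $ 2 * pd 1 \<phi> x - w x $ 1 * pd 2 \<phi> x \<partial>dom_measure D)"
    if \<phi>: "test_fun D \<phi>" for \<phi>
  proof -
    note t1 = test_fun_pd[OF \<phi>] and t2 = test_fun_pd[OF test_fun_pd[OF \<phi>]]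
    note iv = loc_integrable_mult_test[OF D lv t2] and iw = loc_integrable_mult_test[OF D lw t1]
    have comm: "J \<phi> k i j = J \<phi> k j i" for k i j
      unfolding J_def by (simp add: pd_commute[OF test_fun_smooth[OF \<phi>], of i j])
    \<comment> \<open>The equation \<open>h = - \<Delta>v\<close> tested with \<open>\<phi>\<close>; then \<open>div v = 0\<close> and \<open>w = curl v\<close> tested with \<open>pd j \<phi>\<close>.\<close>
    have lap: "(\<integral>x. h x $ k * \<phi> x \<partial>dom_measure D) = - (J \<phi> k 1 1 + J \<phi> k 2 2 + J \<phi> k 3 3)" for k
      using v \<phi> iv by (simp add: A_graph_def J_def sum_3 distrib_left)
    have dv: "J \<phi> 1 1 j + J \<phi> 2 2 j + J \<phi> 3 3 j = 0" for j
    proof -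
      have "(\<integral>x. (\<Sum>i\<in>UNIV. v x $ i * pd i (pd j \<phi>) x) \<partial>dom_measure D) = 0"
        using div t1 by (simp add: div_free_def)
      then show ?thesis using iv by (simp add: J_def sum_3)
    qed
    have rot: "(\<integral>x. w x $ 1 * pd j \<phi> x \<partial>dom_measure D) = - (J \<phi> 3 2 j - J \<phi> 2 3 j)"
      "(\<integral>x. w x $ 2 * pd j \<phi> x \<partial>dom_measure D) = - (J \<phi> 1 3 j - J \<phi> 3 1 j)"
      "(\<integral>x. w x $ 3 * pd j \<phi> x \<partial>dom_measure D) = - (J \<phi> 2 1 j - J \<phi> 1 2 j)" for j
      using w t1[of j] iv by (simp_all add: has_curl_def J_def)
    note c = comm[of _ 1 2] comm[of _ 1 3] comm[of _ 2 3]
    show "(\<integral>x. h x $ 1 * \<phi> x \<partial>dom_measure D) = - (\<integral>x. w x $ 3 * pd 2 \<phi> x - w x $ 2 * pd 3 \<phi> x \<partial>dom_measure D)"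
      using lap[of 1] dv[of 1] rot(3)[of 2] rot(2)[of 3] iw c[of 1] c[of 2] c[of 3] by simp
    show "(\<integral>x. h x $ 2 * \<phi> x \<partial>dom_measure D) = - (\<integral>x. w x $ 1 * pd 3 \<phi> x - w x $ 3 * pd 1 \<phi> x \<partial>dom_measure D)"
      using lap[of 2] dv[of 2] rot(1)[of 3] rot(3)[of 1] iw c[of 1] c[of 2] c[of 3] by simp
    show "(\<integral>x. h x $ 3 * \<phi> x \<partial>dom_measure D) = - (\<integral>x. w x $ 2 * pd 1 \<phi> x - w x $ 1 * pd 2 \<phi> x \<partial>dom_measure D)"
      using lap[of 3] dv[of 3] rot(2)[of 1] rot(1)[of 2] iw c[of 1] c[of 2] c[of 3] by simp
  qed
  show ?thesis
    unfolding has_curl_def using w h goal by (simp add: has_curl_def)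
qed

section \<open>Powers of the operator\<close>

lemma L2_fields_sq: "v \<in> L2_fields D \<Longrightarrow> square_integrable D v"
  by (simp add: L2_fields_def)

lemma L2_fields_cong_AE:
  assumes D: "admissible D" and v: "v \<in> L2_fields D" and eq: "AE x in dom_measure D. w x = v x"
  shows "w \<in> L2_fields D"
proof -
  have v': "v \<in> borel_measurable (dom_measure D)" "integrable (dom_measure D) (\<lambda>x. (norm (v x))\<^sup>2)"
    using v by (auto simp: L2_fields_def square_integrable_def)
  have m: "w \<in> borel_measurable (dom_measure D)"
  proof -
    have R: "region D \<inter> space lebesgue \<in> sets lebesgue" using region_sets[OF D] by simp
    have "(\<lambda>x. indicator (region D) x *\<^sub>R v x) \<in> borel_measurable lebesgue"
      using v'(1) by (simp add: borel_measurable_restrict_space_iff[OF R])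
    moreover have "AE x in lebesgue. x \<in> region D \<longrightarrow> w x = v x"
      using eq by (simp add: AE_restrict_space_iff[OF R])
    then have "AE x in lebesgue. indicator (region D) x *\<^sub>R v x = indicator (region D) x *\<^sub>R w x"
      by eventually_elim (auto simp: indicator_def)
    ultimately have "(\<lambda>x. indicator (region D) x *\<^sub>R w x) \<in> borel_measurable lebesgue"
      by (rule borel_measurable_AE)
    then show ?thesis by (simp add: borel_measurable_restrict_space_iff[OF R])
  qed
  have "integrable (dom_measure D) (\<lambda>x. (norm (w x))\<^sup>2)"
    by (rule integrable_cong_AE[THEN iffD2, OF _ _ _ v'(2)]) (use m v'(1) eq in auto)
  moreover have "mean_condition D w"
  proof (cases D)
    case (Periodic a b)
    then show ?thesis
      using v m v'(1) eq integral_cong_AE[of w "dom_measure D" v] by (simp add: L2_fields_def)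
  qed simp
  ultimately show ?thesis using m by (simp add: L2_fields_def square_integrable_def)
qed

lemma l2_inner_cong_AE:
  assumes "square_integrable D v" "square_integrable D v'" "square_integrable D e"
    and "AE x in dom_measure D. v x = v' x"
  shows "l2_inner D v e = l2_inner D v' e"
  unfolding l2_inner_def
  using assms by (intro integral_cong_AE) (auto simp: square_integrable_def)

lemma l2_inner_diff_left:
  assumes "square_integrable D v" "square_integrable D w" "square_integrable D e"
  shows "l2_inner D (\<lambda>x. v x - w x) e = l2_inner D v e - l2_inner D w e"
  using square_integrable_inner[OF assms(1,3)] square_integrable_inner[OF assms(2,3)]
  by (simp add: l2_inner_def inner_diff_left)

lemma l2_inner_scale_left: "l2_inner D (\<lambda>x. c *\<^sub>R v x) e = c * l2_inner D v e"
  by (simp add: l2_inner_def)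

lemma l2_inner_self: "l2_inner D v v = (l2_norm D v)\<^sup>2"
  by (simp add: l2_inner_def l2_norm_power2 power2_norm_eq_inner)

lemma test_fun_scale:
  assumes "test_fun D \<phi>" shows "test_fun D (\<lambda>x. c * \<phi> x)"
proof (cases D)
  case (Periodic a b)
  then show ?thesis using assms by (simp add: smooth_mult smooth_const)
next
  case (Dirichlet \<Omega>)
  have "{x. c * \<phi> x \<noteq> 0} \<subseteq> closure {x. \<phi> x \<noteq> 0}"
    using closure_subset by fastforce
  then show ?thesis
    using assms Dirichlet smooth_mult smooth_const compact_support_mono[of \<phi> \<Omega> "\<lambda>x. c * \<phi> x"] by simp
qed

lemma H1_bc_scale:
  assumes f: "f \<in> H1_bc D"
  shows "(\<lambda>x. c * f x) \<in> H1_bc D"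
proof -
  obtain G \<phi> where G: "square_integrable D (G :: real^3 \<Rightarrow> real^3)" and \<phi>: "\<And>n. test_fun D (\<phi> n)"
    and lim: "(\<lambda>n. l2_norm D (\<lambda>x. \<phi> n x - f x)) \<longlonglongrightarrow> 0"
    "(\<lambda>n. l2_norm D (\<lambda>x. (\<chi> i. pd i (\<phi> n) x) - G x)) \<longlonglongrightarrow> 0" and sf: "square_integrable D f"
    using f unfolding H1_bc_def by blast
  have pd: "pd i (\<lambda>x. c * \<phi> n x) x = c * pd i (\<phi> n) x" for i n x
  proof -
    have "((\<lambda>x. c * \<phi> n x) has_derivative (\<lambda>h. c * frechet_derivative (\<phi> n) (at x) h)) (at x)"
      by (intro has_derivative_mult_right smooth_has_derivative test_fun_smooth[OF \<phi>])
    from pd_eqI[OF this] show ?thesis by (simp add: pd_def)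
  qed
  have "l2_norm D (\<lambda>x. c * \<phi> n x - c * f x) = \<bar>c\<bar> * l2_norm D (\<lambda>x. \<phi> n x - f x)" for n
    using l2_norm_scale[of D c "\<lambda>x. \<phi> n x - f x"] by (simp add: right_diff_distrib)
  then have 1: "(\<lambda>n. l2_norm D (\<lambda>x. c * \<phi> n x - c * f x)) \<longlonglongrightarrow> 0"
    using tendsto_mult_right_zero[OF lim(1), of "\<bar>c\<bar>"] by simp
  have "(\<lambda>x. (\<chi> i. pd i (\<lambda>x. c * \<phi> n x) x) - c *\<^sub>R G x) = (\<lambda>x. c *\<^sub>R ((\<chi> i. pd i (\<phi> n) x) - G x))" for n
    by (simp add: pd fun_eq_iff vec_eq_iff right_diff_distrib)
  then have 2: "(\<lambda>n. l2_norm D (\<lambda>x. (\<chi> i. pd i (\<lambda>x. c * \<phi> n x) x) - c *\<^sub>R G x)) \<longlonglongrightarrow> 0"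
    using tendsto_mult_right_zero[OF lim(2), of "\<bar>c\<bar>"] by (simp add: l2_norm_scale)
  have "square_integrable D (\<lambda>x. c * f x)" "square_integrable D (\<lambda>x. c *\<^sub>R G x)"
    using square_integrable_scale[OF sf, of c] square_integrable_scale[OF G, of c] by simp_all
  then show ?thesis
    unfolding H1_bc_def mem_Collect_eq using 1 2 test_fun_scale[OF \<phi>]
    by (intro conjI exI[of _ "\<lambda>x. c *\<^sub>R G x"] exI[of _ "\<lambda>n x. c * \<phi> n x"] allI)
qed

lemma L2_fields_scale:
  assumes "v \<in> L2_fields D" shows "(\<lambda>x. c *\<^sub>R v x) \<in> L2_fields D"
  using assms square_integrable_scale by (cases D) (auto simp: L2_fields_def)

lemma A_graph_scale:
  assumes "A_graph D v h"
  shows "A_graph D (\<lambda>x. c *\<^sub>R v x) (\<lambda>x. c *\<^sub>R h x)"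
  unfolding A_graph_def
proof (intro conjI allI impI)
  show "(\<lambda>x. c *\<^sub>R v x) \<in> L2_fields D" "(\<lambda>x. c *\<^sub>R h x) \<in> L2_fields D"
    using assms L2_fields_scale by (auto simp: A_graph_def)
  show "(\<lambda>x. (c *\<^sub>R v x) $ k) \<in> H1_bc D" for k
    using H1_bc_scale[OF A_graph_H1[OF assms], of c k] by simp
  show "(\<integral>x. (c *\<^sub>R h x) $ k * \<phi> x \<partial>dom_measure D)
      = - (\<integral>x. (c *\<^sub>R v x) $ k * (\<Sum>i\<in>UNIV. pd i (pd i \<phi>) x) \<partial>dom_measure D)"
    if "test_fun D \<phi>" for k \<phi>
    using assms that by (simp add: A_graph_def mult.assoc)
qed

lemma eigenspace_scale: "e \<in> eigenspace D l \<Longrightarrow> (\<lambda>x. c *\<^sub>R e x) \<in> eigenspace D l"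
  using A_graph_scale[of D e "\<lambda>x. l *\<^sub>R e x" c] by (simp add: eigenspace_def mult.commute)

lemma eigenspace_sq: "e \<in> eigenspace D l \<Longrightarrow> square_integrable D e"
  using A_graph_sq by (auto simp: eigenspace_def)

lemma eigenprojection_sq: "is_eigenprojection D l v q \<Longrightarrow> square_integrable D q"
  using eigenspace_sq[of q D l] by (simp add: is_eigenprojection_def)

text \<open>Eigenvalues are in fact positive, but \<open>l \<ge> 0\<close> is enough for \<open>l powr (s - 1) * l = l powr s\<close>.\<close>

lemma eigenvalue_nonneg:
  assumes D: "admissible D" and l: "l \<in> eigenvalues D"
  shows "l \<ge> 0"
proof -
  obtain e where e: "A_graph D e (\<lambda>x. l *\<^sub>R e x)" "\<not> (AE x in dom_measure D. e x = 0)"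
    using l by (auto simp: eigenvalues_def eigenspace_def)
  have "l2_norm D e \<noteq> 0"
    using e(2) l2_norm_eq_0_imp_AE[OF A_graph_sq(1)[OF e(1)]] by blast
  then have "(l2_norm D e)\<^sup>2 > 0" by simp
  moreover have "l * (l2_norm D e)\<^sup>2 \<ge> 0"
    using A_graph_nonneg[OF D e(1)] by (simp add: l2_inner_scale_left l2_inner_self)
  ultimately show ?thesis by (simp add: zero_le_mult_iff)
qed

lemma eigenprojection_unique:
  assumes v: "square_integrable D v"
    and q: "is_eigenprojection D l v q" and q': "is_eigenprojection D l v q'"
  shows "AE x in dom_measure D. q x = q' x"
proof -
  have s: "square_integrable D q" "square_integrable D q'"
    using q q' eigenprojection_sq by simp_all
  let ?d = "\<lambda>x. q x - q' x"
  have sd: "square_integrable D ?d" by (rule square_integrable_diff[OF s])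
  have *: "l2_inner D ?d e = 0" if e: "e \<in> eigenspace D l" for e
  proof -
    have "l2_inner D v e - l2_inner D q e = 0" "l2_inner D v e - l2_inner D q' e = 0"
      using q q' e l2_inner_diff_left[OF v _ eigenspace_sq[OF e]] s
      by (auto simp: is_eigenprojection_def)
    then show ?thesis using l2_inner_diff_left[OF s eigenspace_sq[OF e]] by simp
  qed
  have "l2_inner D ?d ?d = l2_inner D ?d q - l2_inner D ?d q'"
    using l2_inner_diff_left[OF s sd] by (simp add: l2_inner_commute)
  also have "\<dots> = 0" using * q q' by (simp add: is_eigenprojection_def)
  finally have "l2_norm D ?d = 0" by (simp add: l2_inner_self)
  from l2_norm_eq_0_imp_AE[OF sd this] show ?thesis by simp
qed

lemma power_graph_unique:
  assumes w: "power_graph D s v w" and w': "power_graph D s v w'"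
  shows "AE x in dom_measure D. w x = w' x"
proof -
  let ?E = "eigenvalues D"
  let ?S = "\<lambda>P F x. \<Sum>l\<in>F. (l powr s) *\<^sub>R P l x :: real^3"
  have sv: "square_integrable D v" and sw: "square_integrable D w" "square_integrable D w'"
    using w w' by (auto simp: power_graph_def L2_fields_sq)
  obtain P where P: "\<And>l. l \<in> ?E \<Longrightarrow> is_eigenprojection D l v (P l)"
    and lim: "((\<lambda>F. l2_norm D (\<lambda>x. ?S P F x - w x)) \<longlongrightarrow> 0) (finite_subsets_at_top ?E)"
    using w by (auto simp: power_graph_def)
  obtain P' where P': "\<And>l. l \<in> ?E \<Longrightarrow> is_eigenprojection D l v (P' l)"
    and lim': "((\<lambda>F. l2_norm D (\<lambda>x. ?S P' F x - w' x)) \<longlongrightarrow> 0) (finite_subsets_at_top ?E)"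
    using w' by (auto simp: power_graph_def)
  have le: "l2_norm D (\<lambda>x. w x - w' x)
      \<le> l2_norm D (\<lambda>x. ?S P F x - w x) + l2_norm D (\<lambda>x. ?S P' F x - w' x)"
    if F: "finite F" "F \<subseteq> ?E" for F
  proof -
    have S: "square_integrable D (?S P F)" "square_integrable D (?S P' F)"
    proof -
      have "square_integrable D (P l)" "square_integrable D (P' l)" if "l \<in> F" for l
        using eigenprojection_sq[OF P] eigenprojection_sq[OF P'] that F(2) by auto
      then show "square_integrable D (?S P F)" "square_integrable D (?S P' F)"
        using F(1) by (auto intro!: square_integrable_sum square_integrable_scale)
    qed
    have "AE x in dom_measure D. \<forall>l\<in>F. P l x = P' l x"
      using F eigenprojection_unique[OF sv P P'] by (intro AE_finite_allI) auto
    then have ae: "AE x in dom_measure D. ?S P F x = ?S P' F x"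
      by eventually_elim simp
    have "l2_norm D (\<lambda>x. w x - w' x)
        = l2_norm D (\<lambda>x. (-1) *\<^sub>R (?S P F x - w x) + (?S P' F x - w' x))"
    proof (rule l2_norm_cong_AE)
      show "AE x in dom_measure D. w x - w' x = (-1) *\<^sub>R (?S P F x - w x) + (?S P' F x - w' x)"
        using ae by eventually_elim simp
    qed (intro square_integrable_add square_integrable_scale square_integrable_diff S sw)+
    also have "\<dots> \<le> l2_norm D (\<lambda>x. (-1) *\<^sub>R (?S P F x - w x)) + l2_norm D (\<lambda>x. ?S P' F x - w' x)"
      by (intro l2_norm_triangle square_integrable_scale square_integrable_diff S sw)
    finally show ?thesis unfolding l2_norm_scale by simp
  qed
  have "l2_norm D (\<lambda>x. w x - w' x) \<le> 0"
  proof (rule tendsto_lowerbound)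
    show "((\<lambda>F. l2_norm D (\<lambda>x. ?S P F x - w x) + l2_norm D (\<lambda>x. ?S P' F x - w' x)) \<longlongrightarrow> 0)
        (finite_subsets_at_top ?E)"
      using tendsto_add[OF lim lim'] by simp
    show "\<forall>\<^sub>F F in finite_subsets_at_top ?E. l2_norm D (\<lambda>x. w x - w' x)
        \<le> l2_norm D (\<lambda>x. ?S P F x - w x) + l2_norm D (\<lambda>x. ?S P' F x - w' x)"
      using le by (intro eventually_finite_subsets_at_top_weakI)
  qed simp
  then have "l2_norm D (\<lambda>x. w x - w' x) = 0"
    using l2_norm_nonneg[of D] by (metis antisym)
  from l2_norm_eq_0_imp_AE[OF square_integrable_diff[OF sw] this] show ?thesis by simp
qed

text \<open>The eigenprojections commute with \<open>A\<close>, because \<open>A\<close> is symmetric. The field \<open>h'\<close> is any other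
  representative of \<open>A v\<close>.\<close>

lemma eigenprojection_A:
  assumes D: "admissible D" and v: "A_graph D v h" and q: "is_eigenprojection D l v q"
    and h': "square_integrable D h'" "AE x in dom_measure D. h' x = h x"
  shows "is_eigenprojection D l h' (\<lambda>x. l *\<^sub>R q x)"
  unfolding is_eigenprojection_def
proof (intro conjI ballI)
  have qE: "q \<in> eigenspace D l" using q by (simp add: is_eigenprojection_def)
  then show "(\<lambda>x. l *\<^sub>R q x) \<in> eigenspace D l" by (rule eigenspace_scale)
  note sv = A_graph_sq[OF v] and sq = eigenspace_sq[OF qE]
  fix e assume e: "e \<in> eigenspace D l"
  note se = eigenspace_sq[OF e]
  have "l2_inner D h' e = l2_inner D h e"
    by (rule l2_inner_cong_AE[OF h'(1) sv(2) se h'(2)])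
  also have "\<dots> = l2_inner D v (\<lambda>x. l *\<^sub>R e x)"
    using A_graph_symmetric[OF D v] e by (simp add: eigenspace_def)
  also have "\<dots> = l * l2_inner D v e"
    by (simp add: l2_inner_commute[of D v] l2_inner_scale_left)
  also have "l2_inner D v e = l2_inner D q e"
    using q e l2_inner_diff_left[OF sv(1) sq se] by (simp add: is_eigenprojection_def)
  finally show "l2_inner D (\<lambda>x. h' x - l *\<^sub>R q x) e = 0"
    using l2_inner_diff_left[OF h'(1) square_integrable_scale[OF sq] se]
    by (simp add: l2_inner_scale_left)
qed

text \<open>The series defining \<open>A\<^sup>s v\<close> and \<open>A\<^sup>s\<^sup>-\<^sup>1 (A v)\<close> agree term by term.\<close>

lemma power_graph_A:
  assumes D: "admissible D" and v: "A_graph D v h" and w: "power_graph D s v w"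
    and h': "h' \<in> L2_fields D" "AE x in dom_measure D. h' x = h x"
  shows "power_graph D (s - 1) h' w"
proof -
  let ?E = "eigenvalues D"
  obtain P where P: "\<And>l. l \<in> ?E \<Longrightarrow> is_eigenprojection D l v (P l)"
    and lim: "((\<lambda>F. l2_norm D (\<lambda>x. (\<Sum>l\<in>F. (l powr s) *\<^sub>R P l x) - w x)) \<longlongrightarrow> 0) (finite_subsets_at_top ?E)"
    using w by (auto simp: power_graph_def)
  \<comment> \<open>The case \<open>l = 0\<close> holds because \<open>0 powr s = 0\<close>, even for \<open>s = 0\<close>.\<close>
  have pw: "l powr (s - 1) * l = l powr s" if "l \<in> ?E" for l
    using eigenvalue_nonneg[OF D that] by (cases "l = 0") (simp_all add: powr_diff)
  have "((\<lambda>F. l2_norm D (\<lambda>x. (\<Sum>l\<in>F. (l powr (s - 1)) *\<^sub>R (l *\<^sub>R P l x)) - w x)) \<longlongrightarrow> 0)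
      (finite_subsets_at_top ?E)"
  proof (rule Lim_transform_eventually[OF lim], rule eventually_finite_subsets_at_top_weakI)
    fix F assume "F \<subseteq> ?E"
    then have "(\<Sum>l\<in>F. (l powr s) *\<^sub>R P l x) = (\<Sum>l\<in>F. (l powr (s - 1)) *\<^sub>R (l *\<^sub>R P l x))" for x
      by (intro sum.cong) (auto simp: pw subset_iff)
    then show "l2_norm D (\<lambda>x. (\<Sum>l\<in>F. (l powr s) *\<^sub>R P l x) - w x)
        = l2_norm D (\<lambda>x. (\<Sum>l\<in>F. (l powr (s - 1)) *\<^sub>R (l *\<^sub>R P l x)) - w x)" by simp
  qed
  moreover have "\<forall>l\<in>?E. is_eigenprojection D l h' (\<lambda>x. l *\<^sub>R P l x)"
    using eigenprojection_A[OF D v P L2_fields_sq[OF h'(1)] h'(2)] by blast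
  ultimately show ?thesis
    unfolding power_graph_def using h'(1) w
    by (auto simp: power_graph_def intro!: exI[of _ "\<lambda>l x. l *\<^sub>R P l x"])
qed

section \<open>Solutions of the Navier-Stokes and Euler systems\<close>

theorem theorem1:
  fixes D :: flow_domain and I :: "real set" and \<nu> s t :: real
    and u g \<omega> :: "real \<Rightarrow> real^3 \<Rightarrow> real^3" and p :: "real \<Rightarrow> real^3 \<Rightarrow> real"
  assumes "admissible D"
    and "is_interval I" and "interior I \<noteq> {}"
    and "(\<nu> > 0 \<and> navier_stokes_solution D \<nu> g I u p) \<or> euler_solution D I u p"
    and "\<And>\<tau>. \<omega> \<tau> = curl D (u \<tau>)"
    and "t \<in> I"
    and "u t \<in> A_power_dom D s"
  shows "curl D (\<omega> t) \<in> A_power_dom D (s - 1) \<and>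
    (AE x in dom_measure D. A_power D s (u t) x = A_power D (s - 1) (curl D (\<omega> t)) x)"
proof -
  note D = assms(1)
  have "u t \<in> A_dom D" and div: "div_free D (u t)"
    using assms(4,6) by (auto simp: navier_stokes_solution_def euler_solution_def)
  then obtain h where h: "A_graph D (u t) h" by (auto simp: A_dom_def)
  have "has_curl D (u t) (\<omega> t)"
    unfolding assms(5) by (rule curl_exists[OF D A_graph_sq(1)[OF h] A_graph_H1[OF h]])
  then have hh: "has_curl D (\<omega> t) h" by (rule curl_curl[OF D h div])
  then have cc: "has_curl D (\<omega> t) (curl D (\<omega> t))"
    unfolding curl_def[of D "\<omega> t"] by (rule someI[of "has_curl D (\<omega> t)"])
  have eq: "AE x in dom_measure D. curl D (\<omega> t) x = h x"
    by (rule curl_unique[OF D cc hh])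
  have L2: "curl D (\<omega> t) \<in> L2_fields D"
    using L2_fields_cong_AE[OF D _ eq] h by (simp add: A_graph_def)
  have w: "power_graph D s (u t) (A_power D s (u t))"
    using assms(7) unfolding A_power_dom_def A_power_def mem_Collect_eq by (rule someI_ex)
  have w1: "power_graph D (s - 1) (curl D (\<omega> t)) (A_power D s (u t))"
    by (rule power_graph_A[OF D h w L2 eq])
  then have "power_graph D (s - 1) (curl D (\<omega> t)) (A_power D (s - 1) (curl D (\<omega> t)))"
    unfolding A_power_def[of D "s - 1"] by (rule someI[of "power_graph D (s - 1) (curl D (\<omega> t))"])
  with w1 show ?thesis
    using power_graph_unique by (auto simp: A_power_dom_def)
qed

end
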